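(* Consider the Gaussian linear model $y=Ax_0+w$ and the regularized $M$-estimation problem $\hat x\in\arg\min_{x\in\mathbb{R}^n}L(y-Ax)+\lambda F(x)$ described in the context, together with its residual-augmented Primary Optimization (PO) and Auxiliary Optimization (AO). Assume the matching assumption (M$'$) and the subgradient selection assumption (S$'$) of the context, with matched solution $(e^*,u^*,r^* )$ and $x^*:=x_0+e^*$. Let $\widehat\kappa,\widehat\mu_r>0$, $\widehat\sigma$, $\widehat\beta$ be the scalars and $a^*=y-Ax^*+\widehat\kappa u^*$, $r_{\rm in}^*=x^*+\widehat\mu_rA^\top u^*$ the vectors defined in the context. Suppose that the scalar AO $\inf_{\sigma\ge0,\tau_g>0}\sup_{\beta\ge0,\tau_h>0}D_{\rm gen}(\sigma,\tau_g,\beta,\tau_h)$ of the context has a unique interior saddle point $(\sigma_*,\tau_{g,*},\beta_*,\tau_{h,*})$. Then there exists a finite-dimensional scalar coefficient $\widehat\tau$ such that the selected AO Gaussian vectors $g,h$ satisfy $$r_{\rm in}^*=x_0+\widehat\tau\,h,\qquad a^*=w+\widehat\sigma\,g,$$ where, as $m,n\to\infty$ with $m/n\to\delta$, $$\widehat\tau\xrightarrow{p}\frac{\sqrt\delta\,\sigma_*\beta_*}{\tau_{h,*}}\qquad\text{and}\qquad\widehat\sigma\xrightarrow{p}\sigma_* .$$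
   Context: Model. $y=Ax_0+w$, with $A\in\mathbb{R}^{m\times n}$, $x_0\in\mathbb{R}^n$, $y,w\in\mathbb{R}^m$, in the proportional regime $m,n\to\infty$, $m/n\to\delta\in(0,\infty)$. The entries of $A$ are independent $\mathcal N(0,1/m)$, and $A$ is independent of $x_0$ and $w$; the entries of $x_0$ are i.i.d. with law $p_{X_0}$ and the entries of $w$ are i.i.d. with law $p_W$. $\xrightarrow{p}$ is convergence in probability. Loss and regularizer. $L(r)=\sum_{i=1}^m\ell(r_i)$ is a separable, proper, closed, convex loss; $F(x)=\sum_{j=1}^n f(x_j)$ with $f:\mathbb{R}\to(-\infty,\infty]$ proper, closed and convex; $\lambda>0$. For $\tau>0$ and convex $\varphi$, $\operatorname{prox}_{\tau\varphi}(a):=\arg\min_x\{\tfrac12\|x-a\|_2^2+\tau\varphi(x)\}$. PO: with $e=x-x_0$, $w=y-Ax_0$, $G=\sqrt m\,A$, $$\min_{e\in\mathbb{R}^n,\,r\in\mathbb{R}^m}\max_{u\in\mathbb{R}^m}\Bigl\{-\tfrac1{\sqrt m}u^\top Ge+u^\top w-u^\top r+L(r)+\lambda F(x_0+e)\Bigr\}.$$ AO: with $g\sim\mathcal N(0,I_m)$, $h\sim\mathcal N(0,I_n)$ independent of each other and of $(x_0,w)$, $$\min_{e\in\mathbb{R}^n,\,r\in\mathbb{R}^m}\max_{u\in\mathbb{R}^m}\Bigl\{\tfrac{\|e\|_2}{\sqrt m}g^\top u-\tfrac{\|u\|_2}{\sqrt m}h^\top e+u^\top w-u^\top r+L(r)+\lambda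 F(x_0+e)\Bigr\}.$$ Assumption (M$'$) (AO–PO matching). Let $(e_{AO}^*,u_{AO}^*,r_{AO}^* )$ and $(e_{PO}^*,u_{PO}^*,r_{PO}^* )$ be saddle points of the AO and the PO. There exist specific auxiliary vectors $g,h$ in the AO such that the KKT solutions match exactly: $e_{AO}^*=e_{PO}^*=:e^*$, $u_{AO}^*=u_{PO}^*=:u^*$, $r_{AO}^*=r_{PO}^*=:r^*$. Although this couples $g,h$ with the PO, the selected $g,h$ are still taken to be independent standard Gaussian AO realizations. Assumption (S$'$) (common subgradient). For the matched optimizers, with $x^*:=x_0+e^*$, there is a single $s^*\in\partial F(x^* )$ satisfying both the PO stationarity condition in $e$, $-A^\top u^*+\lambda s^*=0$, and the AO stationarity condition in $e$, $\frac{g^\top u^*}{\sqrt m\|e^*\|_2}e^*-\frac{\|u^*\|_2}{\sqrt m}h+\lambda s^*=0$. The common pair also satisfies $u^*\in\partial L(r^* )$ in both KKT systems. Finite scalars: $\widehat\sigma:=\frac{\|e^*\|_2}{\sqrt m}$, $\widehat\beta:=\frac{\|u^*\|_2}{\sqrt m}$, $\widehat\mu:=\frac{g^\top u^*}{m\widehat\sigma}$, $\widehat\kappa:=\frac{h^\top e^*}{m\widehat\beta}$, $\widehat\mu_r:=1/\widehat\mu$. With these, $a^*:=y-Ax^*+\widehat\kappa u^*$ and $r_{\rm in}^*:=x^*+\widehat\mu_rA^\top u^*$; they satisfy $u^*=\frac{a^*-\operatorname{prox}_{\widehat\kappa L}(a^* )}{\widehat\kappa}$ and $x^*=\operatorname{prox}_{\lambda\widehat\mu_rF}(r_{\rm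 in}^* )$. Scalar AO. Let $P_L(c,\tau):=\operatorname{prox}_{\tau L}(cg+w)$, $P_F(c,\tau):=\operatorname{prox}_{\tau F}(x_0+ch)$, and $$\mathcal L(c,\tau):=\lim_{m\to\infty}\frac1m\Bigl[\tfrac1{2\tau}\|cg+w-P_L(c,\tau)\|_2^2+L(P_L(c,\tau))\Bigr],$$ $$\mathcal F(c,\tau):=\lim_{n\to\infty}\frac1n\Bigl[\tfrac1{2\tau}\|x_0+ch-P_F(c,\tau)\|_2^2+F(P_F(c,\tau))\Bigr].$$ Then $$D_{\rm gen}(\sigma,\tau_g,\beta,\tau_h):=\frac{\delta\beta\tau_g}{2}+\delta\,\mathcal L\Bigl(\sigma,\frac{\tau_g}{\beta}\Bigr)-\frac{\sigma\sqrt\delta\,\tau_h}{2}-\frac{\sigma\sqrt\delta\,\beta^2}{2\tau_h}+\lambda\,\mathcal F\Bigl(\frac{\sigma\sqrt\delta\,\beta}{\tau_h},\frac{\sigma\sqrt\delta\,\lambda}{\tau_h}\Bigr).$$ *)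

theory Defs
  imports "HOL-Probability.Probability"
begin

text \<open>Vectors of length \<open>d\<close> are functions \<^typ>\<open>nat \<Rightarrow> real\<close> of which only the entries with index
  \<open>< d\<close> are used; an \<open>m \<times> n\<close> matrix is read on \<open>{..<m} \<times> {..<n}\<close>. The dimensions have to be
  numbers, not types, because they tend to infinity.\<close>

type_synonym rvec = "nat \<Rightarrow> real"
type_synonym rmat = "nat \<Rightarrow> nat \<Rightarrow> real"

definition vdot :: "nat \<Rightarrow> rvec \<Rightarrow> rvec \<Rightarrow> real" where
  "vdot d x y = (\<Sum>i<d. x i * y i)"

definition vnorm :: "nat \<Rightarrow> rvec \<Rightarrow> real" where
  "vnorm d x = L2_set x {..<d}"

definition mat_vec :: "nat \<Rightarrow> rmat \<Rightarrow> rvec \<Rightarrow> rvec" where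
  "mat_vec n A x = (\<lambda>i. \<Sum>j<n. A i j * x j)"

definition matT_vec :: "nat \<Rightarrow> rmat \<Rightarrow> rvec \<Rightarrow> rvec" where
  "matT_vec m A u = (\<lambda>j. \<Sum>i<m. A i j * u i)"


subsection \<open>Convex analysis for extended-real-valued functions\<close>

definition epi :: "(real \<Rightarrow> ereal) \<Rightarrow> (real \<times> real) set" where
  "epi \<phi> = {(x, t). \<phi> x \<le> ereal t}"

definition proper_closed_convex :: "(real \<Rightarrow> ereal) \<Rightarrow> bool" where
  "proper_closed_convex \<phi> \<longleftrightarrow>
     (\<forall>x. \<phi> x \<noteq> - \<infinity>) \<and> (\<exists>x. \<phi> x \<noteq> \<infinity>) \<and> closed (epi \<phi>) \<and> convex (epi \<phi>)"

definition separable_sum :: "nat \<Rightarrow> (real \<Rightarrow> ereal) \<Rightarrow> rvec \<Rightarrow> ereal" where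
  "separable_sum d \<phi> x = (\<Sum>i<d. \<phi> (x i))"

text \<open>For a proper \<open>\<Phi>\<close> the inequality below already forces \<open>\<Phi> x < \<infinity>\<close>.\<close>

definition subdifferential :: "nat \<Rightarrow> (rvec \<Rightarrow> ereal) \<Rightarrow> rvec \<Rightarrow> rvec set" where
  "subdifferential d \<Phi> x =
     {s. \<forall>z. \<Phi> x + ereal (vdot d s (\<lambda>i. z i - x i)) \<le> \<Phi> z}"

text \<open>\<open>prox d \<tau> \<Phi> a\<close> is \<open>prox\<^bsub>\<tau>\<Phi>\<^esub>(a)\<close> in dimension \<open>d\<close>. Minimising over extensional functions only
  fixes the irrelevant entries with index \<open>\<ge> d\<close>, so that the minimiser is unique.\<close>

definition prox :: "nat \<Rightarrow> real \<Rightarrow> (rvec \<Rightarrow> ereal) \<Rightarrow> rvec \<Rightarrow> rvec" where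
  "prox d \<tau> \<Phi> a =
     arg_min (\<lambda>x. ereal ((vnorm d (\<lambda>i. x i - a i))\<^sup>2 / 2) + ereal \<tau> * \<Phi> x)
       (\<lambda>x. x \<in> extensional {..<d})"

text \<open>The normalised value \<open>1/d [\<parallel>a - P\<parallel>\<^sup>2 / (2\<tau>) + \<Phi>(P)]\<close> at \<open>P = prox\<^bsub>\<tau>\<Phi>\<^esub>(a)\<close>. For proper, closed,
  convex \<open>\<Phi>\<close> and \<open>\<tau> > 0\<close> the number \<open>\<Phi>(P)\<close> is finite, so nothing is lost by
  \<^const>\<open>real_of_ereal\<close>.\<close>

definition prox_value :: "nat \<Rightarrow> real \<Rightarrow> (rvec \<Rightarrow> ereal) \<Rightarrow> rvec \<Rightarrow> real" where
  "prox_value d \<tau> \<Phi> a =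
     (1 / real d) * (1 / (2 * \<tau>) * (vnorm d (\<lambda>i. a i - prox d \<tau> \<Phi> a i))\<^sup>2
                      + real_of_ereal (\<Phi> (prox d \<tau> \<Phi> a)))"

definition saddle_point ::
  "('a \<Rightarrow> 'b \<Rightarrow> ereal) \<Rightarrow> 'a set \<Rightarrow> 'b set \<Rightarrow> 'a \<Rightarrow> 'b \<Rightarrow> bool" where
  "saddle_point \<Psi> X Y x y \<longleftrightarrow> x \<in> X \<and> y \<in> Y \<and>
     (\<forall>y'\<in>Y. \<Psi> x y' \<le> \<Psi> x y) \<and> (\<forall>x'\<in>X. \<Psi> x y \<le> \<Psi> x' y)"


subsection \<open>Probabilistic notions\<close>

text \<open>Convergence in probability to a constant; every \<open>X k\<close> may live on its own space.\<close>

definition tendsto_in_prob ::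
  "(nat \<Rightarrow> 'w measure) \<Rightarrow> (nat \<Rightarrow> 'w \<Rightarrow> real) \<Rightarrow> real \<Rightarrow> bool" where
  "tendsto_in_prob M X l \<longleftrightarrow> (\<forall>k. X k \<in> borel_measurable (M k)) \<and>
     (\<forall>\<epsilon>>0. (\<lambda>k. measure (M k) {\<omega> \<in> space (M k). \<bar>X k \<omega> - l\<bar> > \<epsilon>}) \<longlonglongrightarrow> 0)"

text \<open>\<^const>\<open>prob_space.indep_var\<close> forces both variables to have the same value type.\<close>

definition indep_rv ::
  "'w measure \<Rightarrow> 'b measure \<Rightarrow> ('w \<Rightarrow> 'b) \<Rightarrow> 'c measure \<Rightarrow> ('w \<Rightarrow> 'c) \<Rightarrow> bool" where
  "indep_rv M S X T Y \<longleftrightarrow> X \<in> measurable M S \<and> Y \<in> measurable M T \<and>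
     prob_space.indep_set M {X -` B \<inter> space M | B. B \<in> sets S} {Y -` C \<inter> space M | C. C \<in> sets T}"

definition vec_space :: "nat \<Rightarrow> rvec measure" where
  "vec_space d = (\<Pi>\<^sub>M i\<in>{..<d}. borel)"

definition mat_space :: "nat \<Rightarrow> nat \<Rightarrow> (nat \<times> nat \<Rightarrow> real) measure" where
  "mat_space m n = (\<Pi>\<^sub>M p\<in>{..<m} \<times> {..<n}. borel)"

definition rand_vec :: "nat \<Rightarrow> ('w \<Rightarrow> rvec) \<Rightarrow> 'w \<Rightarrow> rvec" where
  "rand_vec d X \<omega> = restrict (X \<omega>) {..<d}"

definition rand_mat :: "nat \<Rightarrow> nat \<Rightarrow> ('w \<Rightarrow> rmat) \<Rightarrow> 'w \<Rightarrow> nat \<times> nat \<Rightarrow> real" where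
  "rand_mat m n A \<omega> = (\<lambda>p\<in>{..<m} \<times> {..<n}. A \<omega> (fst p) (snd p))"

definition iid_vec :: "'w measure \<Rightarrow> nat \<Rightarrow> real measure \<Rightarrow> ('w \<Rightarrow> rvec) \<Rightarrow> bool" where
  "iid_vec M d p X \<longleftrightarrow> prob_space.indep_vars M (\<lambda>_. borel) (\<lambda>i \<omega>. X \<omega> i) {..<d} \<and>
     (\<forall>i<d. distr M borel (\<lambda>\<omega>. X \<omega> i) = p)"

definition std_gaussian_vec :: "'w measure \<Rightarrow> nat \<Rightarrow> ('w \<Rightarrow> rvec) \<Rightarrow> bool" where
  "std_gaussian_vec M d X \<longleftrightarrow> prob_space.indep_vars M (\<lambda>_. borel) (\<lambda>i \<omega>. X \<omega> i) {..<d} \<and>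
     (\<forall>i<d. distributed M lborel (\<lambda>\<omega>. X \<omega> i) std_normal_density)"

text \<open>Note that \<^const>\<open>normal_density\<close> takes the standard deviation: the entries of \<open>A\<close> have
  variance \<open>1/m\<close>. Independence of \<open>x0\<close> from \<open>w\<close> is not required.\<close>

definition gaussian_linear_model ::
  "'w measure \<Rightarrow> nat \<Rightarrow> nat \<Rightarrow> real measure \<Rightarrow> real measure \<Rightarrow>
   ('w \<Rightarrow> rmat) \<Rightarrow> ('w \<Rightarrow> rvec) \<Rightarrow> ('w \<Rightarrow> rvec) \<Rightarrow> bool" where
  "gaussian_linear_model M m n pX pW A x0 w \<longleftrightarrow>
     prob_space.indep_vars M (\<lambda>_. borel) (\<lambda>p \<omega>. A \<omega> (fst p) (snd p)) ({..<m} \<times> {..<n}) \<and>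
     (\<forall>i<m. \<forall>j<n. distributed M lborel (\<lambda>\<omega>. A \<omega> i j) (normal_density 0 (1 / sqrt (real m)))) \<and>
     iid_vec M n pX x0 \<and> iid_vec M m pW w \<and>
     indep_rv M (mat_space m n) (rand_mat m n A)
       (vec_space n \<Otimes>\<^sub>M vec_space m) (\<lambda>\<omega>. (rand_vec n x0 \<omega>, rand_vec m w \<omega>))"

definition AO_gaussians ::
  "'w measure \<Rightarrow> nat \<Rightarrow> nat \<Rightarrow> ('w \<Rightarrow> rvec) \<Rightarrow> ('w \<Rightarrow> rvec) \<Rightarrow> ('w \<Rightarrow> rvec) \<Rightarrow> ('w \<Rightarrow> rvec) \<Rightarrow> bool" where
  "AO_gaussians M m n x0 w g h \<longleftrightarrow>
     std_gaussian_vec M m g \<and> std_gaussian_vec M n h \<and>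
     indep_rv M (vec_space m) (rand_vec m g) (vec_space n) (rand_vec n h) \<and>
     indep_rv M (vec_space m \<Otimes>\<^sub>M vec_space n) (\<lambda>\<omega>. (rand_vec m g \<omega>, rand_vec n h \<omega>))
       (vec_space n \<Otimes>\<^sub>M vec_space m) (\<lambda>\<omega>. (rand_vec n x0 \<omega>, rand_vec m w \<omega>))"


subsection \<open>Primary and auxiliary optimization\<close>

definition PO_objective ::
  "nat \<Rightarrow> nat \<Rightarrow> (rvec \<Rightarrow> ereal) \<Rightarrow> (rvec \<Rightarrow> ereal) \<Rightarrow> real \<Rightarrow> rmat \<Rightarrow> rvec \<Rightarrow> rvec \<Rightarrow>
   rvec \<times> rvec \<Rightarrow> rvec \<Rightarrow> ereal" where
  "PO_objective m n L F lam A x0 w = (\<lambda>(e, r) u.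
     (let G = (\<lambda>i j. sqrt (real m) * A i j) in
      ereal (- (1 / sqrt (real m)) * vdot m u (mat_vec n G e) + vdot m u w - vdot m u r)
      + L r + ereal lam * F (\<lambda>j. x0 j + e j)))"

definition AO_objective ::
  "nat \<Rightarrow> nat \<Rightarrow> (rvec \<Rightarrow> ereal) \<Rightarrow> (rvec \<Rightarrow> ereal) \<Rightarrow> real \<Rightarrow> rvec \<Rightarrow> rvec \<Rightarrow> rvec \<Rightarrow> rvec \<Rightarrow>
   rvec \<times> rvec \<Rightarrow> rvec \<Rightarrow> ereal" where
  "AO_objective m n L F lam g h x0 w = (\<lambda>(e, r) u.
     ereal (vnorm n e / sqrt (real m) * vdot m g u - vnorm m u / sqrt (real m) * vdot n h e
            + vdot m u w - vdot m u r)
     + L r + ereal lam * F (\<lambda>j. x0 j + e j))"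

definition matched_solution ::
  "nat \<Rightarrow> nat \<Rightarrow> (rvec \<Rightarrow> ereal) \<Rightarrow> (rvec \<Rightarrow> ereal) \<Rightarrow> real \<Rightarrow> rmat \<Rightarrow> rvec \<Rightarrow> rvec \<Rightarrow> rvec \<Rightarrow> rvec \<Rightarrow>
   rvec \<Rightarrow> rvec \<Rightarrow> rvec \<Rightarrow> bool" where
  "matched_solution m n L F lam A x0 w g h e u r \<longleftrightarrow>
     saddle_point (PO_objective m n L F lam A x0 w) UNIV UNIV (e, r) u \<and>
     saddle_point (AO_objective m n L F lam g h x0 w) UNIV UNIV (e, r) u"

definition common_subgradient ::
  "nat \<Rightarrow> nat \<Rightarrow> (rvec \<Rightarrow> ereal) \<Rightarrow> (rvec \<Rightarrow> ereal) \<Rightarrow> real \<Rightarrow> rmat \<Rightarrow> rvec \<Rightarrow> rvec \<Rightarrow> rvec \<Rightarrow>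
   rvec \<Rightarrow> rvec \<Rightarrow> rvec \<Rightarrow> bool" where
  "common_subgradient m n L F lam A x0 g h e u r \<longleftrightarrow>
     (\<exists>s \<in> subdifferential n F (\<lambda>j. x0 j + e j).
        (\<forall>j<n. - matT_vec m A u j + lam * s j = 0) \<and>
        (\<forall>j<n. vdot m g u / (sqrt (real m) * vnorm n e) * e j
               - vnorm m u / sqrt (real m) * h j + lam * s j = 0)) \<and>
     u \<in> subdifferential m L r"


subsection \<open>Finite-dimensional scalars and vectors\<close>

definition sigma_hat :: "nat \<Rightarrow> nat \<Rightarrow> rvec \<Rightarrow> real" where
  "sigma_hat m n e = vnorm n e / sqrt (real m)"

definition beta_hat :: "nat \<Rightarrow> rvec \<Rightarrow> real" where
  "beta_hat m u = vnorm m u / sqrt (real m)"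

definition mu_hat :: "nat \<Rightarrow> nat \<Rightarrow> rvec \<Rightarrow> rvec \<Rightarrow> rvec \<Rightarrow> real" where
  "mu_hat m n g e u = vdot m g u / (real m * sigma_hat m n e)"

definition kappa_hat :: "nat \<Rightarrow> nat \<Rightarrow> rvec \<Rightarrow> rvec \<Rightarrow> rvec \<Rightarrow> real" where
  "kappa_hat m n h e u = vdot n h e / (real m * beta_hat m u)"

definition mu_r_hat :: "nat \<Rightarrow> nat \<Rightarrow> rvec \<Rightarrow> rvec \<Rightarrow> rvec \<Rightarrow> real" where
  "mu_r_hat m n g e u = 1 / mu_hat m n g e u"

definition observation :: "nat \<Rightarrow> rmat \<Rightarrow> rvec \<Rightarrow> rvec \<Rightarrow> rvec" where
  "observation n A x0 w = (\<lambda>i. mat_vec n A x0 i + w i)"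

definition a_star :: "nat \<Rightarrow> rmat \<Rightarrow> rvec \<Rightarrow> rvec \<Rightarrow> real \<Rightarrow> rvec \<Rightarrow> rvec" where
  "a_star n A y x \<kappa> u = (\<lambda>i. y i - mat_vec n A x i + \<kappa> * u i)"

definition r_in :: "nat \<Rightarrow> rmat \<Rightarrow> rvec \<Rightarrow> real \<Rightarrow> rvec \<Rightarrow> rvec" where
  "r_in m A x \<mu>\<^sub>r u = (\<lambda>j. x j + \<mu>\<^sub>r * matT_vec m A u j)"


subsection \<open>The scalar auxiliary optimization\<close>

definition D_gen ::
  "real \<Rightarrow> real \<Rightarrow> (real \<Rightarrow> real \<Rightarrow> real) \<Rightarrow> (real \<Rightarrow> real \<Rightarrow> real) \<Rightarrow>
   real \<Rightarrow> real \<Rightarrow> real \<Rightarrow> real \<Rightarrow> real" where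
  "D_gen \<delta> lam \<L> \<F> \<sigma> \<tau>g \<beta> \<tau>h =
     \<delta> * \<beta> * \<tau>g / 2 + \<delta> * \<L> \<sigma> (\<tau>g / \<beta>) - \<sigma> * sqrt \<delta> * \<tau>h / 2 - \<sigma> * sqrt \<delta> * \<beta>\<^sup>2 / (2 * \<tau>h)
     + lam * \<F> (\<sigma> * sqrt \<delta> * \<beta> / \<tau>h) (\<sigma> * sqrt \<delta> * lam / \<tau>h)"

text \<open>The formula for \<open>D_gen\<close> divides by \<open>\<beta>\<close> and evaluates \<open>\<F>\<close> at proximal parameter proportional to
  \<open>\<sigma>\<close>, so it is meaningful for \<open>\<sigma> > 0\<close>, \<open>\<beta> > 0\<close> only. The faces \<open>\<sigma> = 0\<close> and \<open>\<beta> = 0\<close> of the domain of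
  the min-max problem carry the limiting values from the interior (lower limit in the
  minimisation variable, upper limit in the maximisation variable).\<close>

definition D_gen_ext ::
  "real \<Rightarrow> real \<Rightarrow> (real \<Rightarrow> real \<Rightarrow> real) \<Rightarrow> (real \<Rightarrow> real \<Rightarrow> real) \<Rightarrow>
   real \<times> real \<Rightarrow> real \<times> real \<Rightarrow> ereal" where
  "D_gen_ext \<delta> lam \<L> \<F> = (\<lambda>(\<sigma>, \<tau>g) (\<beta>, \<tau>h).
     if \<sigma> > 0 \<and> \<beta> > 0 then ereal (D_gen \<delta> lam \<L> \<F> \<sigma> \<tau>g \<beta> \<tau>h)
     else if \<beta> > 0 then Liminf (at_right 0) (\<lambda>s. ereal (D_gen \<delta> lam \<L> \<F> s \<tau>g \<beta> \<tau>h))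
     else if \<sigma> > 0 then Limsup (at_right 0) (\<lambda>b. ereal (D_gen \<delta> lam \<L> \<F> \<sigma> \<tau>g b \<tau>h))
     else Liminf (at_right 0) (\<lambda>s. Limsup (at_right 0) (\<lambda>b. ereal (D_gen \<delta> lam \<L> \<F> s \<tau>g b \<tau>h))))"

definition scalar_AO_saddle ::
  "real \<Rightarrow> real \<Rightarrow> (real \<Rightarrow> real \<Rightarrow> real) \<Rightarrow> (real \<Rightarrow> real \<Rightarrow> real) \<Rightarrow>
   real \<Rightarrow> real \<Rightarrow> real \<Rightarrow> real \<Rightarrow> bool" where
  "scalar_AO_saddle \<delta> lam \<L> \<F> \<sigma> \<tau>g \<beta> \<tau>h \<longleftrightarrow>
     saddle_point (D_gen_ext \<delta> lam \<L> \<F>) ({0..} \<times> {0<..}) ({0..} \<times> {0<..}) (\<sigma>, \<tau>g) (\<beta>, \<tau>h)"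

definition unique_interior_saddle ::
  "real \<Rightarrow> real \<Rightarrow> (real \<Rightarrow> real \<Rightarrow> real) \<Rightarrow> (real \<Rightarrow> real \<Rightarrow> real) \<Rightarrow>
   real \<Rightarrow> real \<Rightarrow> real \<Rightarrow> real \<Rightarrow> bool" where
  "unique_interior_saddle \<delta> lam \<L> \<F> \<sigma> \<tau>g \<beta> \<tau>h \<longleftrightarrow>
     \<sigma> > 0 \<and> \<tau>g > 0 \<and> \<beta> > 0 \<and> \<tau>h > 0 \<and> scalar_AO_saddle \<delta> lam \<L> \<F> \<sigma> \<tau>g \<beta> \<tau>h \<and>
     (\<forall>\<sigma>' \<tau>g' \<beta>' \<tau>h'. \<sigma>' > 0 \<and> \<tau>g' > 0 \<and> \<beta>' > 0 \<and> \<tau>h' > 0 \<and>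
        scalar_AO_saddle \<delta> lam \<L> \<F> \<sigma>' \<tau>g' \<beta>' \<tau>h' \<longrightarrow>
        \<sigma>' = \<sigma> \<and> \<tau>g' = \<tau>g \<and> \<beta>' = \<beta> \<and> \<tau>h' = \<tau>h)"

end

theory Submission
  imports Defs
begin

text \<open>Put \<open>z = (\<sigma>, \<tau>\<^sub>g; \<beta>, \<tau>\<^sub>h)\<close>. For finite \<open>m, n\<close>, minimising over \<open>(e, r)\<close> only, with \<open>\<parallel>e\<parallel>\<close> and the
  maximisation over the direction of \<open>u\<close> replaced by the quadratic penalties with parameters \<open>\<tau>\<^sub>h\<close> and \<open>\<tau>\<^sub>g\<close>, gives
  a random function of \<open>z\<close> that is convex in \<open>(\<sigma>, \<tau>\<^sub>g)\<close>, concave in \<open>(\<beta>, \<tau>\<^sub>h)\<close> and converges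
  pointwise in probability to \<open>D\<^bsub>gen\<^esub>\<close>. The KKT conditions of the matched solution, combined with
  Young's inequality, show without any minimax theorem that
  \<open>(\<sigma>_hat, \<kappa>_hat \<beta>_hat; \<beta>_hat, sqrt \<delta> \<sigma>_hat \<mu>_hat)\<close> is a saddle point of this function. A unique
  saddle point of a limit of convex-concave functions is stable under pointwise convergence, and a
  compactness argument reduces the stability to finitely many points, so that a union bound gives
  convergence in probability of the four scalars. The two identities come from comparing the
  stationarity conditions of the two problems: in \<open>e\<close> they give
  \<open>A\<^sup>T u = \<beta>_hat h - \<mu>_hat e\<close>, in \<open>u\<close> they give \<open>r = w - A e\<close> and
  \<open>\<sigma>_hat g + w - r = \<kappa>_hat u\<close>; hence \<open>\<tau>_hat = \<beta>_hat / \<mu>_hat\<close>.\<close>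

subsection \<open>Convergence in probability\<close>

text \<open>Takes the place of almost surely convergent subsequences, which would require a common
  probability space.\<close>

lemma tendsto_in_prob_finite_control:
  assumes prob: "\<And>k. prob_space (M k)"
    and meas: "\<And>k. Y k \<in> borel_measurable (M k)"
    and ctrl: "\<And>\<epsilon>. \<epsilon> > 0 \<Longrightarrow> \<exists>S \<eta>. finite S \<and> \<eta> > 0 \<and> (\<forall>p\<in>S. tendsto_in_prob M (X p) (l p)) \<and>
      (\<forall>\<^sub>F k in sequentially. AE \<omega> in M k. (\<forall>p\<in>S. \<bar>X p k \<omega> - l p\<bar> \<le> \<eta>) \<longrightarrow> \<bar>Y k \<omega> - y\<bar> \<le> \<epsilon>)"
  shows "tendsto_in_prob M Y y"
  unfolding tendsto_in_prob_def
proof (intro conjI allI impI)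
  fix k show "Y k \<in> borel_measurable (M k)" by (rule meas)
next
  fix \<epsilon> :: real assume "\<epsilon> > 0"
  from ctrl[OF this] obtain S \<eta> where S: "finite S" "\<eta> > 0"
    "\<And>p. p \<in> S \<Longrightarrow> tendsto_in_prob M (X p) (l p)"
    "\<forall>\<^sub>F k in sequentially. AE \<omega> in M k. (\<forall>p\<in>S. \<bar>X p k \<omega> - l p\<bar> \<le> \<eta>) \<longrightarrow> \<bar>Y k \<omega> - y\<bar> \<le> \<epsilon>"
    by blast
  define B where "B = (\<lambda>p k. {\<omega> \<in> space (M k). \<bar>X p k \<omega> - l p\<bar> > \<eta>})"
  have meas_X: "X p k \<in> borel_measurable (M k)" if "p \<in> S" for p k
    using S(3)[OF that] unfolding tendsto_in_prob_def by blast
  have B: "B p k \<in> sets (M k)" if "p \<in> S" for p k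
  proof -
    note [measurable] = meas_X[OF that]
    show ?thesis unfolding B_def by measurable
  qed
  have "(\<lambda>k. measure (M k) (B p k)) \<longlonglongrightarrow> 0" if "p \<in> S" for p
    using S(3)[OF that] S(2) unfolding tendsto_in_prob_def B_def by blast
  hence lim: "(\<lambda>k. \<Sum>p\<in>S. measure (M k) (B p k)) \<longlonglongrightarrow> 0"
    by (rule tendsto_null_sum)
  have "\<forall>\<^sub>F k in sequentially.
      measure (M k) {\<omega> \<in> space (M k). \<bar>Y k \<omega> - y\<bar> > \<epsilon>} \<le> (\<Sum>p\<in>S. measure (M k) (B p k))"
    using S(4)
  proof eventually_elim
    case (elim k)
    interpret prob_space "M k" by (rule prob)
    note [measurable] = meas
    have "measure (M k) {\<omega> \<in> space (M k). \<bar>Y k \<omega> - y\<bar> > \<epsilon>} \<le> measure (M k) (\<Union>p\<in>S. B p k)"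
    proof (rule finite_measure_mono_AE)
      show "AE \<omega> in M k. \<omega> \<in> {\<omega> \<in> space (M k). \<bar>Y k \<omega> - y\<bar> > \<epsilon>} \<longrightarrow> \<omega> \<in> (\<Union>p\<in>S. B p k)"
        using elim by eventually_elim (force simp: B_def not_le)
    qed (use B S(1) in auto)
    also have "\<dots> \<le> (\<Sum>p\<in>S. measure (M k) (B p k))"
      using B S(1) by (intro finite_measure_subadditive_finite) auto
    finally show ?case .
  qed
  thus "(\<lambda>k. measure (M k) {\<omega> \<in> space (M k). \<bar>Y k \<omega> - y\<bar> > \<epsilon>}) \<longlonglongrightarrow> 0"
    by (rule tendsto_sandwich[rotated 1, OF _ tendsto_const lim]) simp
qed

lemma tendsto_in_prob_add:
  assumes prob: "\<And>k. prob_space (M k)"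
    and X: "tendsto_in_prob M X a" and Y: "tendsto_in_prob M Y b"
  shows "tendsto_in_prob M (\<lambda>k \<omega>. X k \<omega> + Y k \<omega>) (a + b)"
proof (rule tendsto_in_prob_finite_control[OF prob,
      where X="\<lambda>p. if p then X else Y" and l="\<lambda>p. if p then a else b"])
  fix k
  have [measurable]: "X k \<in> borel_measurable (M k)" "Y k \<in> borel_measurable (M k)"
    using X Y by (auto simp: tendsto_in_prob_def)
  show "(\<lambda>\<omega>. X k \<omega> + Y k \<omega>) \<in> borel_measurable (M k)" by measurable
next
  fix \<epsilon> :: real assume "\<epsilon> > 0"
  have "\<bar>x + y - (a + b)\<bar> \<le> \<epsilon>" if "\<bar>x - a\<bar> \<le> \<epsilon> / 2" "\<bar>y - b\<bar> \<le> \<epsilon> / 2" for x y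
    using that by linarith
  with \<open>\<epsilon> > 0\<close> show "\<exists>S \<eta>. finite S \<and> \<eta> > 0 \<and>
      (\<forall>p\<in>S. tendsto_in_prob M (if p then X else Y) (if p then a else b)) \<and>
      (\<forall>\<^sub>F k in sequentially. AE \<omega> in M k.
        (\<forall>p\<in>S. \<bar>(if p then X else Y) k \<omega> - (if p then a else b)\<bar> \<le> \<eta>) \<longrightarrow>
        \<bar>X k \<omega> + Y k \<omega> - (a + b)\<bar> \<le> \<epsilon>)"
    using X Y by (intro exI[of _ "{True, False}"] exI[of _ "\<epsilon> / 2"])
      (auto intro!: always_eventually)
qed

text \<open>The coefficient is deterministic but varies with \<open>k\<close>, as
  \<open>m k / n k\<close> does. Joint continuity of multiplication at \<open>(c0, a)\<close> treats
  both errors at once.\<close>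

lemma tendsto_in_prob_mult_left:
  assumes prob: "\<And>k. prob_space (M k)"
    and c: "c \<longlonglongrightarrow> c0" and X: "tendsto_in_prob M X a"
  shows "tendsto_in_prob M (\<lambda>k \<omega>. c k * X k \<omega>) (c0 * a)"
proof (rule tendsto_in_prob_finite_control[OF prob, where X="\<lambda>_::unit. X" and l="\<lambda>_. a"])
  fix k
  have [measurable]: "X k \<in> borel_measurable (M k)"
    using X by (auto simp: tendsto_in_prob_def)
  show "(\<lambda>\<omega>. c k * X k \<omega>) \<in> borel_measurable (M k)" by measurable
next
  fix \<epsilon> :: real assume "\<epsilon> > 0"
  have "\<forall>\<^sub>F p in nhds (c0, a). dist (fst p * snd p) (c0 * a) < \<epsilon>"
    using \<open>\<epsilon> > 0\<close> by (intro tendstoD tendsto_mult tendsto_fst[where a="(c0, a)", simplified]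
        tendsto_snd[where a="(c0, a)", simplified]) (auto simp: filterlim_ident)
  then obtain d where d: "d > 0" "\<And>p. dist p (c0, a) < d \<Longrightarrow> dist (fst p * snd p) (c0 * a) < \<epsilon>"
    by (auto simp: eventually_nhds_metric)
  \<comment> \<open>The shares \<open>d / 2\<close> and \<open>d / 3\<close> add up to less than
    \<open>d\<close>; the second is a non-strict bound, in the form that the control lemma
    uses.\<close>
  have "\<forall>\<^sub>F k in sequentially. dist (c k) c0 < d / 2"
    using c d(1) by (intro tendstoD) auto
  hence "\<forall>\<^sub>F k in sequentially. AE \<omega> in M k. \<bar>X k \<omega> - a\<bar> \<le> d / 3 \<longrightarrow> \<bar>c k * X k \<omega> - c0 * a\<bar> \<le> \<epsilon>"
  proof (eventually_elim, intro AE_I2 impI)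
    fix k \<omega> assume "dist (c k) c0 < d / 2" "\<bar>X k \<omega> - a\<bar> \<le> d / 3"
    moreover have "dist (c k, X k \<omega>) (c0, a) \<le> dist (c k) c0 + dist (X k \<omega>) a"
      by (simp add: dist_Pair_Pair sqrt_sum_squares_le_sum)
    ultimately have "dist (c k, X k \<omega>) (c0, a) < d" using d(1) by (simp add: dist_real_def)
    from d(2)[OF this] show "\<bar>c k * X k \<omega> - c0 * a\<bar> \<le> \<epsilon>" by (simp add: dist_real_def)
  qed
  thus "\<exists>S \<eta>. finite S \<and> \<eta> > 0 \<and> (\<forall>p\<in>S. tendsto_in_prob M X a) \<and>
      (\<forall>\<^sub>F k in sequentially. AE \<omega> in M k.
        (\<forall>p\<in>(S::unit set). \<bar>X k \<omega> - a\<bar> \<le> \<eta>) \<longrightarrow> \<bar>c k * X k \<omega> - c0 * a\<bar> \<le> \<epsilon>)"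
    using X d(1) by (intro exI[of _ UNIV] exI[of _ "d / 3"]) auto
qed

lemma tendsto_in_prob_const:
  assumes prob: "\<And>k. prob_space (M k)" and c: "c \<longlonglongrightarrow> c0"
  shows "tendsto_in_prob M (\<lambda>k \<omega>. c k) c0"
proof (rule tendsto_in_prob_finite_control[OF prob, where X="\<lambda>_::unit. \<lambda>_ _. 0" and l="\<lambda>_. 0"])
  fix \<epsilon> :: real assume "\<epsilon> > 0"
  with c have "\<forall>\<^sub>F k in sequentially. dist (c k) c0 < \<epsilon>" by (rule tendstoD)
  hence "\<forall>\<^sub>F k in sequentially. AE \<omega> in M k. \<bar>c k - c0\<bar> \<le> \<epsilon>"
    by eventually_elim (simp add: dist_real_def)
  \<comment> \<open>The empty set of controls works, because the bound holds everywhere once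
    \<open>k\<close> is large.\<close>
  thus "\<exists>S \<eta>. finite S \<and> \<eta> > 0 \<and> (\<forall>p\<in>S. tendsto_in_prob M (\<lambda>_ _. 0) 0) \<and>
      (\<forall>\<^sub>F k in sequentially. AE \<omega> in M k.
        (\<forall>p\<in>(S::unit set). \<bar>0 - 0 :: real\<bar> \<le> \<eta>) \<longrightarrow> \<bar>c k - c0\<bar> \<le> \<epsilon>)"
    by (intro exI[of _ "{}"] exI[of _ "1::real"]) simp
qed simp

section \<open>Weak law of large numbers for the squared norm of a Gaussian vector\<close>

lemma std_normal_centered_square_moments:
  assumes "prob_space M" and X: "distributed M lborel X std_normal_density"
  defines "Z \<equiv> \<lambda>\<omega>. (X \<omega>)\<^sup>2 - 1"
  shows "integrable M Z" "integral\<^sup>L M Z = 0" "integrable M (\<lambda>\<omega>. (Z \<omega>)\<^sup>2)" "integral\<^sup>L M (\<lambda>\<omega>. (Z \<omega>)\<^sup>2) = 2"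
proof -
  interpret prob_space M by fact
  have int: "integrable M (\<lambda>\<omega>. X \<omega> ^ (2 * j))" for j
    using distributed_integrable[OF X, of "\<lambda>x. x ^ (2 * j)"] integrable_std_normal_moment by simp
  have E: "expectation (\<lambda>\<omega>. X \<omega> ^ (2 * j)) = fact (2 * j) / (2 ^ j * fact j)" for j
    using distributed_integral[OF X, of "\<lambda>x. x ^ (2 * j)"] integral_std_normal_moment_even by simp
  note m = int[of 1] int[of 2] E[of 1] E[of 2]
  have sq: "(Z \<omega>)\<^sup>2 = X \<omega> ^ (2 * 2) - 2 * X \<omega> ^ (2 * 1) + 1" for \<omega>
    by (simp add: Z_def power2_eq_square power4_eq_xxxx algebra_simps)
  show "integrable M Z" "integral\<^sup>L M Z = 0"
    using m by (auto simp: Z_def prob_space fact_numeral)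
  show "integrable M (\<lambda>\<omega>. (Z \<omega>)\<^sup>2)" "integral\<^sup>L M (\<lambda>\<omega>. (Z \<omega>)\<^sup>2) = 2"
    using m unfolding sq by (auto simp: prob_space fact_numeral)
qed

text \<open>Chebyshev's inequality for a sum of \<open>d\<close> independent centered variables
  \<open>(h i)^2 - 1\<close>, each of variance 2.\<close>

lemma std_gaussian_vec_sq_norm_deviation:
  assumes "prob_space M" and h: "std_gaussian_vec M d h" and "d > 0" "\<epsilon> > 0"
  shows "measure M {\<omega> \<in> space M. \<bar>vdot d (h \<omega>) (h \<omega>) / real d - 1\<bar> > \<epsilon>} \<le> 2 / (\<epsilon>\<^sup>2 * real d)"
proof -
  interpret prob_space M by fact
  define Z where "Z = (\<lambda>i \<omega>. (h \<omega> i)\<^sup>2 - 1)"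
  have dist: "distributed M lborel (\<lambda>\<omega>. h \<omega> i) std_normal_density" if "i < d" for i
    using h that by (simp add: std_gaussian_vec_def)
  have mom: "integrable M (Z i)" "expectation (Z i) = 0"
      "integrable M (\<lambda>\<omega>. (Z i \<omega>)\<^sup>2)" "expectation (\<lambda>\<omega>. (Z i \<omega>)\<^sup>2) = 2" if "i < d" for i
    using std_normal_centered_square_moments[OF assms(1) dist[OF that]] by (simp_all add: Z_def)
  have meas: "random_variable borel (\<lambda>\<omega>. h \<omega> i)" if "i < d" for i
    using distributed_measurable[OF dist[OF that]] by simp
  have indep: "indep_vars (\<lambda>_. borel) Z {..<d}"
    unfolding Z_def using h indep_vars_compose2[of "\<lambda>_. borel" "\<lambda>i \<omega>. h \<omega> i" "{..<d}" "\<lambda>_ x. x\<^sup>2 - 1" "\<lambda>_. borel"]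
    by (simp add: std_gaussian_vec_def)
  \<comment> \<open>Distinct factors are independent and centered, so only the diagonal contributes
    to the second moment of \<open>S\<close>.\<close>
  have ZZ: "integrable M (\<lambda>\<omega>. Z i \<omega> * Z j \<omega>) \<and> expectation (\<lambda>\<omega>. Z i \<omega> * Z j \<omega>) = (if i = j then 2 else 0)"
    if "i < d" "j < d" for i j
  proof (cases "i = j")
    case True thus ?thesis using mom(3,4)[OF that(1)] by (simp add: power2_eq_square)
  next
    case False
    have "indep_vars (\<lambda>_. borel) Z {i, j}" using indep that by (rule_tac indep_vars_subset) auto
    from indep_vars_lebesgue_integral[OF _ this] indep_vars_integrable[OF _ this] False
    show ?thesis using mom(1,2) that by auto
  qed
  define S where "S = (\<lambda>\<omega>. \<Sum>i<d. Z i \<omega>)"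
  have S2: "(S \<omega>)\<^sup>2 = (\<Sum>i<d. \<Sum>j<d. Z i \<omega> * Z j \<omega>)" for \<omega>
    by (simp add: S_def power2_eq_square sum_product)
  have int: "integrable M (\<lambda>\<omega>. (S \<omega>)\<^sup>2)" unfolding S2 using ZZ by (intro Bochner_Integration.integrable_sum) auto
  have "expectation (\<lambda>\<omega>. (S \<omega>)\<^sup>2) = (\<Sum>i<d. \<Sum>j<d. expectation (\<lambda>\<omega>. Z i \<omega> * Z j \<omega>))"
    unfolding S2 using ZZ by (subst Bochner_Integration.integral_sum; (intro sum.cong Bochner_Integration.integrable_sum)?) (auto simp: Bochner_Integration.integral_sum)
  also have "\<dots> = (\<Sum>i<d. \<Sum>j<d. if i = j then 2 else 0)" using ZZ by (intro sum.cong) auto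
  finally have ES2: "expectation (\<lambda>\<omega>. (S \<omega>)\<^sup>2) = 2 * real d" by simp
  have measS[measurable]: "random_variable borel S" unfolding S_def Z_def using meas by measurable
  have ES: "expectation S = 0" unfolding S_def using mom by (subst Bochner_Integration.integral_sum) auto
  have "prob {\<omega> \<in> space M. \<bar>vdot d (h \<omega>) (h \<omega>) / real d - 1\<bar> > \<epsilon>} \<le> prob {\<omega> \<in> space M. \<bar>S \<omega> - expectation S\<bar> \<ge> \<epsilon> * real d}"
  proof (rule finite_measure_mono)
    have "S \<omega> = (vdot d (h \<omega>) (h \<omega>) / real d - 1) * real d" for \<omega>
      using \<open>d > 0\<close> by (simp add: S_def Z_def vdot_def sum_subtractf power2_eq_square field_simps)
    thus "{\<omega> \<in> space M. \<bar>vdot d (h \<omega>) (h \<omega>) / real d - 1\<bar> > \<epsilon>} \<subseteq> {\<omega> \<in> space M. \<bar>S \<omega> - expectation S\<bar> \<ge> \<epsilon> * real d}"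
      using \<open>d > 0\<close> by (auto simp: ES abs_mult)
  qed measurable
  also have "\<dots> \<le> variance S / (\<epsilon> * real d)\<^sup>2"
    using assms int by (intro Chebyshev_inequality) auto
  also have "\<dots> = 2 / (\<epsilon>\<^sup>2 * real d)"
    using ES ES2 assms by (simp add: power2_eq_square field_simps)
  finally show ?thesis .
qed

lemma std_gaussian_vec_sq_norm_tendsto:
  assumes prob: "\<And>k. prob_space (M k)" and h: "\<And>k. std_gaussian_vec (M k) (n k) (h k)"
    and n: "\<And>k. n k > 0" "filterlim n at_top sequentially"
  shows "tendsto_in_prob M (\<lambda>k \<omega>. vdot (n k) (h k \<omega>) (h k \<omega>) / real (n k)) 1"
  unfolding tendsto_in_prob_def
proof (intro conjI allI impI)
  fix k
  have "(\<lambda>\<omega>. h k \<omega> i) \<in> borel_measurable (M k)" if "i < n k" for i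
    using h[of k] that distributed_measurable by (fastforce simp: std_gaussian_vec_def)
  thus "(\<lambda>\<omega>. vdot (n k) (h k \<omega>) (h k \<omega>) / real (n k)) \<in> borel_measurable (M k)"
    unfolding vdot_def by measurable
next
  fix \<epsilon> :: real assume "\<epsilon> > 0"
  have "(\<lambda>k. 2 / (\<epsilon>\<^sup>2 * real (n k))) \<longlonglongrightarrow> 0"
    using \<open>\<epsilon> > 0\<close> by (intro tendsto_divide_0[OF tendsto_const] filterlim_at_top_imp_at_infinity
      filterlim_tendsto_pos_mult_at_top[OF tendsto_const] filterlim_compose[OF filterlim_real_sequentially n(2)]) auto
  thus "(\<lambda>k. measure (M k) {\<omega> \<in> space (M k). \<bar>vdot (n k) (h k \<omega>) (h k \<omega>) / real (n k) - 1\<bar> > \<epsilon>}) \<longlonglongrightarrow> 0"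
    by (rule tendsto_sandwich[OF _ _ tendsto_const, rotated 2])
       (use std_gaussian_vec_sq_norm_deviation[OF prob h n(1) \<open>\<epsilon> > 0\<close>] in auto)
qed

subsection \<open>Stability of saddle points\<close>

text \<open>A convex \<open>g\<close> is bounded above on a box by its values at the finitely many
  corners. If \<open>g x\<close> were far below \<open>f x0\<close> at some \<open>x\<close> near
  \<open>x0\<close>, convexity on the segment from \<open>x\<close> through \<open>x0\<close> to a
  point of the box would push \<open>g x0\<close> below \<open>f x0\<close>. Hence closeness at
  finitely many points gives a lower bound on a whole neighbourhood, uniform in
  \<open>g\<close>.\<close>

lemma convex_local_lower_bound:
  fixes f :: "'a::euclidean_space \<Rightarrow> real"
  assumes "open P" and "x0 \<in> P" and "\<epsilon> > 0"
  obtains S \<eta> U where "finite S" and "S \<subseteq> P" and "\<eta> > 0" and "open U" and "x0 \<in> U"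
    and "\<And>g x. \<lbrakk>convex_on P g; \<forall>p\<in>S. \<bar>g p - f p\<bar> \<le> \<eta>; x \<in> U; x \<in> P\<rbrakk> \<Longrightarrow> g x > f x0 - \<epsilon>"
proof -
  obtain a b where ab: "cbox a b \<subseteq> P" "x0 \<in> box a b"
    using open_contains_cbox[OF assms(1,2)] by metis
  obtain C where C: "finite C" "cbox a b = convex hull C"
    using closed_interval_as_convex_hull[of a b] by metis
  define S where "S = insert x0 C"
  \<comment> \<open>The summand 1 absorbs the error \<open>\<eta> \<le> 1\<close>, so that
    \<open>Mx\<close> also bounds \<open>g\<close> at the corners; it also makes the denominator of
    \<open>s\<close> positive.\<close>
  define Mx where "Mx = Max (f ` S) + 1"
  define \<eta> where "\<eta> = min 1 (\<epsilon> / 2)"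
  define s where "s = \<epsilon> / (4 * (Mx + \<epsilon> - f x0))"
  have fin: "finite S" using C by (simp add: S_def)
  have Mge: "f p \<le> Mx - 1" if "p \<in> S" for p using that fin by (simp add: Mx_def)
  have pos: "Mx - f x0 \<ge> 1" using Mge[of x0] by (simp add: S_def)
  have s: "0 < s" "s < 1" and sM: "s * (Mx + \<epsilon> - f x0) = \<epsilon> / 4"
    using pos assms(3) by (auto simp: s_def field_simps)
  have \<eta>: "\<eta> > 0" "\<eta> \<le> 1" "\<eta> \<le> \<epsilon> / 2" using assms(3) by (auto simp: \<eta>_def)
  obtain d where d: "d > 0" "ball x0 d \<subseteq> box a b"
    using ab(2) open_box open_contains_ball by blast
  have SP: "S \<subseteq> P" using C(2) ab(1) assms(2) hull_subset[of C convex] by (auto simp: S_def)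
  show thesis
  proof (rule that[of S \<eta> "ball x0 (s * d)"])
    show "x0 \<in> ball x0 (s * d)" using s d by simp
    fix g x assume g: "convex_on P g" "\<forall>p\<in>S. \<bar>g p - f p\<bar> \<le> \<eta>" and x: "x \<in> ball x0 (s * d)" "x \<in> P"
    \<comment> \<open>The point beyond \<open>x0\<close> as seen from \<open>x\<close>, placed so
      that \<open>x0 = (1 - s) x + s p\<close>. The radius \<open>s * d\<close> of the neighbourhood
      keeps \<open>p\<close> in the box.\<close>
    define p where "p = x0 + ((1 - s) / s) *\<^sub>R (x0 - x)"
    have "norm (x0 - p) = (1 - s) / s * norm (x0 - x)" using s by (simp add: p_def)
    also have "\<dots> < (1 - s) / s * (s * d)"
      using x s by (intro mult_strict_left_mono) (auto simp: dist_norm)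
    also have "\<dots> \<le> d" using s d by (simp add: mult_left_le_one_le)
    finally have pc: "p \<in> cbox a b" using d(2) box_subset_cbox by (force simp: dist_norm)
    have "g q \<le> Mx" if "q \<in> C" for q using g(2) Mge[of q] \<eta> that by (force simp: S_def)
    moreover have "convex_on (convex hull C) g" using g(1) ab(1) C(2) convex_on_subset convex_convex_hull
      by metis
    ultimately have gp: "g p \<le> Mx" using convex_on_convex_hull_bound pc C(2) by metis
    have "s *\<^sub>R p = s *\<^sub>R x0 + (1 - s) *\<^sub>R (x0 - x)" using s by (simp add: p_def scaleR_add_right)
    hence "(1 - s) *\<^sub>R x + s *\<^sub>R p = x0" by (simp add: algebra_simps)
    moreover have "g ((1 - s) *\<^sub>R x + s *\<^sub>R p) \<le> (1 - s) * g x + s * g p"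
      using g(1) s x pc ab(1) by (intro convex_onD[where A=P]) auto
    ultimately have 1: "g x0 \<le> (1 - s) * g x + s * Mx"
      using gp s by (smt (verit) mult_left_mono)
    have "f x0 - \<eta> \<le> g x0" using g(2) by (auto simp: S_def abs_le_iff)
    \<comment> \<open>The losses are \<open>\<eta> \<le> \<epsilon> / 2\<close> from the value at
      \<open>x0\<close> and \<open>\<epsilon> / 4\<close> from the weight \<open>s\<close> on
      \<open>p\<close>, together less than \<open>\<epsilon>\<close>.\<close>
    hence "(1 - s) * (f x0 - \<epsilon>) < (1 - s) * g x"
      using 1 sM \<eta> assms(3) by (simp add: algebra_simps)
    thus "f x0 - \<epsilon> < g x" using s by simp
  qed (use fin \<eta> SP in auto)
qed

text \<open>The pair \<open>(x1, y1)\<close> witnesses that \<open>(x', y')\<close> is not a saddle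
  point of \<open>D\<close>. The local lower bound, applied to \<open>D\<close> in \<open>x\<close>
  at \<open>y1\<close> and to \<open>- D x1\<close> in \<open>y\<close>, carries this gap over to
  all nearby points and all convex-concave \<open>g\<close> close to \<open>D\<close>. The
  comparison with \<open>max 0 (g x0 y1 - g x1 y0)\<close> is the form that interpolation from
  \<open>(x0, y0)\<close> requires.\<close>

lemma saddle_point_separation:
  fixes D :: "'a::euclidean_space \<Rightarrow> 'b::euclidean_space \<Rightarrow> real"
  assumes "open P" "open Q" and xy0: "x0 \<in> P" "y0 \<in> Q"
    and sad: "\<And>x y. x \<in> P \<Longrightarrow> y \<in> Q \<Longrightarrow> D x0 y \<le> D x y0"
    and x': "x' \<in> P" "y' \<in> Q" and not_sad: "x1 \<in> P" "y1 \<in> Q" "D x1 y' < D x' y1"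
  obtains S \<eta> W where "finite S" and "S \<subseteq> P \<times> Q" and "\<eta> > 0" and "open W" and "(x', y') \<in> W"
    and "\<And>g x y. \<lbrakk>\<forall>y\<in>Q. convex_on P (\<lambda>x. g x y); \<forall>x\<in>P. concave_on Q (g x);
           \<forall>p\<in>S. \<bar>g (fst p) (snd p) - D (fst p) (snd p)\<bar> \<le> \<eta>; (x, y) \<in> W; x \<in> P; y \<in> Q\<rbrakk>
         \<Longrightarrow> max 0 (g x0 y1 - g x1 y0) < g x y1 - g x1 y"
proof -
  \<comment> \<open>Of the gap \<open>4 \<epsilon>\<close>, the two local bounds use
    \<open>2 \<epsilon>\<close>, and replacing \<open>D\<close> by \<open>g\<close> at the two
    points involving \<open>x0\<close> and \<open>y0\<close> costs at most
    \<open>2 \<eta> \<le> \<epsilon>\<close>.\<close>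
  define \<epsilon> where "\<epsilon> = (D x' y1 - D x1 y') / 4"
  have \<epsilon>: "\<epsilon> > 0" using not_sad by (simp add: \<epsilon>_def)
  obtain S1 \<eta>1 U where 1: "finite S1" "S1 \<subseteq> P" "\<eta>1 > 0" "open U" "x' \<in> U"
    "\<And>g x. \<lbrakk>convex_on P g; \<forall>p\<in>S1. \<bar>g p - D p y1\<bar> \<le> \<eta>1; x \<in> U; x \<in> P\<rbrakk> \<Longrightarrow> g x > D x' y1 - \<epsilon>"
    using convex_local_lower_bound[OF assms(1) x'(1) \<epsilon>, of "\<lambda>x. D x y1"] by metis
  obtain S2 \<eta>2 V where 2: "finite S2" "S2 \<subseteq> Q" "\<eta>2 > 0" "open V" "y' \<in> V"
    "\<And>g x. \<lbrakk>convex_on Q g; \<forall>p\<in>S2. \<bar>g p - - D x1 p\<bar> \<le> \<eta>2; x \<in> V; x \<in> Q\<rbrakk> \<Longrightarrow> g x > - D x1 y' - \<epsilon>"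
    using convex_local_lower_bound[OF assms(2) x'(2) \<epsilon>, of "\<lambda>y. - D x1 y"] by metis
  define S where "S = {(x0, y1), (x1, y0)} \<union> S1 \<times> {y1} \<union> {x1} \<times> S2"
  define \<eta> where "\<eta> = Min {\<eta>1, \<eta>2, \<epsilon> / 2}"
  have \<eta>: "\<eta> > 0" "\<eta> \<le> \<eta>1" "\<eta> \<le> \<eta>2" "\<eta> \<le> \<epsilon> / 2" using 1(3) 2(3) \<epsilon> by (auto simp: \<eta>_def)
  show thesis
  proof (rule that[of S \<eta> "U \<times> V"])
    fix g x y
    assume g: "\<forall>y\<in>Q. convex_on P (\<lambda>x. g x y)" "\<forall>x\<in>P. concave_on Q (g x)"
      and cl: "\<forall>p\<in>S. \<bar>g (fst p) (snd p) - D (fst p) (snd p)\<bar> \<le> \<eta>" and xy: "(x, y) \<in> U \<times> V" "x \<in> P" "y \<in> Q"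
    have "g x y1 > D x' y1 - \<epsilon>"
      using cl \<eta> xy g(1) not_sad by (intro 1(6)) (force simp: S_def)+
    moreover have "- g x1 y > - D x1 y' - \<epsilon>"
    proof (rule 2(6))
      show "convex_on Q (\<lambda>y. - g x1 y)" using g(2) not_sad by (simp add: concave_on_def)
      show "\<forall>p\<in>S2. \<bar>- g x1 p - - D x1 p\<bar> \<le> \<eta>2"
      proof
        fix p assume "p \<in> S2"
        hence "(x1, p) \<in> S" by (simp add: S_def)
        with cl have "\<bar>g x1 p - D x1 p\<bar> \<le> \<eta>" by fastforce
        thus "\<bar>- g x1 p - - D x1 p\<bar> \<le> \<eta>2" using \<eta> by simp
      qed
    qed (use xy in auto)
    moreover have "\<bar>g x0 y1 - D x0 y1\<bar> \<le> \<eta>" "\<bar>g x1 y0 - D x1 y0\<bar> \<le> \<eta>" using cl by (auto simp: S_def)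
    moreover have "D x0 y1 \<le> D x1 y0" using sad not_sad by simp
    ultimately show "max 0 (g x0 y1 - g x1 y0) < g x y1 - g x1 y"
      using \<eta> \<epsilon> unfolding \<epsilon>_def by (simp add: field_simps)
  qed (use 1(1-5) 2(1-5) \<eta> xy0 not_sad in \<open>auto simp: S_def open_Times\<close>)
qed

text \<open>If \<open>(x, y)\<close> were a far away saddle point of \<open>g\<close>, the point at distance \<open>\<rho>'\<close> on the segment from
  \<open>(x0, y0)\<close> to \<open>(x, y)\<close> would be an approximate saddle point of \<open>g\<close> by convexity, whereas no point
  of the sphere is an approximate saddle point of \<open>D\<close>. Nothing is assumed on \<open>D\<close> beyond uniqueness.\<close>

lemma saddle_point_stability:
  fixes D :: "'a::euclidean_space \<Rightarrow> 'b::euclidean_space \<Rightarrow> real"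
  assumes "open P" "open Q" and xy0: "x0 \<in> P" "y0 \<in> Q"
    and sad: "\<And>x y. x \<in> P \<Longrightarrow> y \<in> Q \<Longrightarrow> D x0 y \<le> D x y0"
    and uniq: "\<And>x' y'. x' \<in> P \<Longrightarrow> y' \<in> Q \<Longrightarrow> (\<And>x y. x \<in> P \<Longrightarrow> y \<in> Q \<Longrightarrow> D x' y \<le> D x y') \<Longrightarrow>
                 (x', y') = (x0, y0)"
    and "\<rho> > 0"
  obtains S \<eta> where "finite S" and "S \<subseteq> P \<times> Q" and "\<eta> > 0"
    and "\<And>g x y. \<lbrakk>\<forall>y\<in>Q. convex_on P (\<lambda>x. g x y); \<forall>x\<in>P. concave_on Q (g x);
           \<forall>p\<in>S. \<bar>g (fst p) (snd p) - D (fst p) (snd p)\<bar> \<le> \<eta>; x \<in> P; y \<in> Q;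
           \<And>x' y'. x' \<in> P \<Longrightarrow> y' \<in> Q \<Longrightarrow> g x y' \<le> g x' y\<rbrakk>
         \<Longrightarrow> dist (x0, y0) (x, y) < \<rho>"
proof -
  have "open (P \<times> Q)" "(x0, y0) \<in> P \<times> Q" using assms(1-4) by (auto simp: open_Times)
  then obtain r where r: "r > 0" "cball (x0, y0) r \<subseteq> P \<times> Q"
    using open_contains_cball by blast
  \<comment> \<open>The sphere of this radius lies inside \<open>P \<times> Q\<close>, where the
    saddle inequalities are available.\<close>
  define \<rho>' where "\<rho>' = min r \<rho>"
  have \<rho>': "\<rho>' > 0" "\<rho>' \<le> \<rho>" using r assms(7) by (auto simp: \<rho>'_def)
  define K where "K = sphere (x0, y0) \<rho>'"
  have "K \<subseteq> cball (x0, y0) r" by (auto simp: K_def \<rho>'_def)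
  hence KPQ: "K \<subseteq> P \<times> Q" using r(2) by blast
  have "compact K" by (simp add: K_def)
  define sep where "sep = (\<lambda>z S \<eta> W. finite S \<and> S \<subseteq> P \<times> Q \<and> \<eta> > 0 \<and> open W \<and> z \<in> W \<and>
    (\<forall>g x y. (\<forall>y\<in>Q. convex_on P (\<lambda>x. g x y)) \<longrightarrow> (\<forall>x\<in>P. concave_on Q (g x)) \<longrightarrow>
       (\<forall>p\<in>S. \<bar>g (fst p) (snd p) - D (fst p) (snd p)\<bar> \<le> (\<eta>::real)) \<longrightarrow>
       (x, y) \<in> W \<longrightarrow> x \<in> P \<longrightarrow> y \<in> Q \<longrightarrow>
       (\<exists>x1\<in>P. \<exists>y1\<in>Q. max 0 (g x0 y1 - g x1 y0) < g x y1 - g x1 y)))"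
  have sepD: "\<exists>x1\<in>P. \<exists>y1\<in>Q. max 0 (g x0 y1 - g x1 y0) < g x y1 - g x1 y"
    if "sep z S \<eta> W" "\<forall>y\<in>Q. convex_on P (\<lambda>x. g x y)" "\<forall>x\<in>P. concave_on Q (g x)"
       "\<forall>p\<in>S. \<bar>g (fst p) (snd p) - D (fst p) (snd p)\<bar> \<le> \<eta>" "(x, y) \<in> W" "x \<in> P" "y \<in> Q"
    for z S \<eta> W g x y
    using that(1)[unfolded sep_def, THEN conjunct2, THEN conjunct2, THEN conjunct2, THEN conjunct2,
        THEN conjunct2, THEN spec, of g, THEN spec, of x, THEN spec, of y] that(2-)
    by simp
  \<comment> \<open>By uniqueness no point of the sphere is a saddle point of \<open>D\<close>, so
    each one has a separating neighbourhood. Compactness then leaves finitely many control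
    points.\<close>
  have "\<exists>S \<eta> W. sep z S \<eta> W" if z: "z \<in> K" for z
  proof -
    obtain x' y' where z': "z = (x', y')" "x' \<in> P" "y' \<in> Q" using z KPQ by (metis mem_Sigma_iff subsetD surj_pair)
    have "z \<noteq> (x0, y0)" using z \<rho>' by (auto simp: K_def)
    then obtain x1 y1 where "x1 \<in> P" "y1 \<in> Q" "D x1 y' < D x' y1"
      using uniq[of x' y'] z' by (meson not_le)
    from saddle_point_separation[OF assms(1-4) sad z'(2,3) this] obtain S \<eta> W where
      "finite S" "S \<subseteq> P \<times> Q" "\<eta> > 0" "open W" "(x', y') \<in> W"
      "\<And>g x y. \<lbrakk>\<forall>y\<in>Q. convex_on P (\<lambda>x. g x y); \<forall>x\<in>P. concave_on Q (g x);
           \<forall>p\<in>S. \<bar>g (fst p) (snd p) - D (fst p) (snd p)\<bar> \<le> \<eta>; (x, y) \<in> W; x \<in> P; y \<in> Q\<rbrakk>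
         \<Longrightarrow> max 0 (g x0 y1 - g x1 y0) < g x y1 - g x1 y" by blast
    hence "sep z S \<eta> W" unfolding sep_def using z'(1) \<open>x1 \<in> P\<close> \<open>y1 \<in> Q\<close> by blast
    thus ?thesis by blast
  qed
  then obtain S \<eta> W where sep: "\<And>z. z \<in> K \<Longrightarrow> sep z (S z) (\<eta> z) (W z)" by metis
  have "K \<subseteq> (\<Union>z\<in>K. W z)" and "\<And>z. z \<in> K \<Longrightarrow> open (W z)" using sep unfolding sep_def by blast+
  then obtain C where C: "C \<subseteq> K" "finite C" "K \<subseteq> (\<Union>z\<in>C. W z)"
    using compactE_image[OF \<open>compact K\<close>, of K W] by metis
  define T where "T = (\<Union>z\<in>C. S z)"
  \<comment> \<open>Inserting 1 keeps the minimum well defined for empty \<open>C\<close>.\<close>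
  define \<theta> where "\<theta> = Min (insert 1 (\<eta> ` C))"
  have \<theta>: "\<theta> > 0" "\<And>z. z \<in> C \<Longrightarrow> \<theta> \<le> \<eta> z"
    using C sep unfolding \<theta>_def sep_def by (auto simp: subset_iff)
  show thesis
  proof (rule that[of T \<theta>])
    show "finite T" "T \<subseteq> P \<times> Q" using C sep unfolding T_def sep_def by blast+
    fix g x y
    assume g: "\<forall>y\<in>Q. convex_on P (\<lambda>x. g x y)" "\<forall>x\<in>P. concave_on Q (g x)"
      and cl: "\<forall>p\<in>T. \<bar>g (fst p) (snd p) - D (fst p) (snd p)\<bar> \<le> \<theta>" and xy: "x \<in> P" "y \<in> Q"
      and gs: "\<And>x' y'. x' \<in> P \<Longrightarrow> y' \<in> Q \<Longrightarrow> g x y' \<le> g x' y"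
    show "dist (x0, y0) (x, y) < \<rho>"
    proof (rule ccontr)
      assume "\<not> ?thesis"
      define l where "l = dist (x0, y0) (x, y)"
      have l: "l \<ge> \<rho>'" "l > 0" using \<open>\<not> _\<close> \<rho>' by (auto simp: l_def)
      \<comment> \<open>This weight puts the interpolated point \<open>(xt, yt)\<close> exactly on
        the sphere.\<close>
      define t where "t = \<rho>' / l"
      have t: "0 < t" "t \<le> 1" using l \<rho>' by (auto simp: t_def)
      define xt where "xt = (1 - t) *\<^sub>R x0 + t *\<^sub>R x"
      define yt where "yt = (1 - t) *\<^sub>R y0 + t *\<^sub>R y"
      have "(x0, y0) - (xt, yt) = t *\<^sub>R ((x0, y0) - (x, y))" by (simp add: xt_def yt_def algebra_simps)
      hence "dist (x0, y0) (xt, yt) = t * l" using t by (simp only: dist_norm l_def norm_scaleR abs_of_pos)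
      hence K: "(xt, yt) \<in> K" using l by (simp add: K_def t_def)
      then obtain z where z: "z \<in> C" "(xt, yt) \<in> W z" using C(3) by blast
      have "\<forall>p\<in>S z. \<bar>g (fst p) (snd p) - D (fst p) (snd p)\<bar> \<le> \<eta> z"
        using cl z(1) \<theta>(2)[OF z(1)] unfolding T_def by fastforce
      then obtain x1 y1 where 1: "x1 \<in> P" "y1 \<in> Q" "max 0 (g x0 y1 - g x1 y0) < g xt y1 - g x1 yt"
        using sepD[OF sep g] z C(1) K KPQ by blast
      have "g xt y1 \<le> (1 - t) * g x0 y1 + t * g x y1"
        unfolding xt_def using g(1) 1 xy0 xy t by (intro convex_onD[where A=P]) auto
      moreover have "g x1 yt \<ge> (1 - t) * g x1 y0 + t * g x1 y"
        unfolding yt_def using g(2) 1 xy0 xy t by (intro concave_onD[where A=Q]) auto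
      \<comment> \<open>The saddle property of \<open>(x, y)\<close> removes its contribution to the
        gap at \<open>(xt, yt)\<close>; what remains is a fraction of the gap at
        \<open>(x0, y0)\<close>, contradicting the separation.\<close>
      moreover have "t * g x y1 \<le> t * g x1 y" using gs[OF 1(1,2)] t by simp
      ultimately have "g xt y1 - g x1 yt \<le> (1 - t) * (g x0 y1 - g x1 y0)" by (simp add: algebra_simps)
      also have "\<dots> \<le> (1 - t) * max 0 (g x0 y1 - g x1 y0)" using t by (intro mult_left_mono) auto
      also have "\<dots> \<le> 1 * max 0 (g x0 y1 - g x1 y0)" using t by (intro mult_right_mono) auto
      finally show False using 1(3) by simp
    qed
  qed (use \<theta> in auto)
qed

subsection \<open>Proximal envelopes\<close>

lemma vnorm_sq: "(vnorm d x)\<^sup>2 = (\<Sum>i<d. (x i)\<^sup>2)"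
  by (simp add: vnorm_def L2_set_def sum_nonneg)

lemma proper_closed_convex_real:
  "proper_closed_convex \<phi> \<Longrightarrow> \<phi> x \<noteq> \<infinity> \<Longrightarrow> ereal (real_of_ereal (\<phi> x)) = \<phi> x"
  by (cases "\<phi> x") (auto simp: proper_closed_convex_def)

lemma separable_sum_finite:
  assumes "proper_closed_convex \<phi>" and "\<And>i. i < d \<Longrightarrow> \<phi> (x i) \<noteq> \<infinity>"
  shows "separable_sum d \<phi> x = ereal (\<Sum>i<d. real_of_ereal (\<phi> (x i)))"
proof -
  have "separable_sum d \<phi> x = (\<Sum>i<d. ereal (real_of_ereal (\<phi> (x i))))"
    unfolding separable_sum_def using assms
    by (intro sum.cong) (auto simp: proper_closed_convex_real)
  thus ?thesis by simp
qed

lemma separable_sum_eq_PInf_iff: "separable_sum d \<phi> x = \<infinity> \<longleftrightarrow> (\<exists>i<d. \<phi> (x i) = \<infinity>)"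
  by (auto simp: separable_sum_def sum_Pinfty)

lemma proper_closed_convex_combination:
  assumes "proper_closed_convex \<phi>" and "\<phi> x \<noteq> \<infinity>" "\<phi> y \<noteq> \<infinity>" and t: "0 \<le> t" "t \<le> 1"
  shows "\<phi> ((1 - t) * x + t * y) \<noteq> \<infinity>"
    and "real_of_ereal (\<phi> ((1 - t) * x + t * y)) \<le> (1 - t) * real_of_ereal (\<phi> x) + t * real_of_ereal (\<phi> y)"
proof -
  have cvx: "convex (epi \<phi>)"
    using assms(1) by (auto simp: proper_closed_convex_def)
  have "(x, real_of_ereal (\<phi> x)) \<in> epi \<phi>" "(y, real_of_ereal (\<phi> y)) \<in> epi \<phi>"
    using assms(2,3) by (auto simp: epi_def proper_closed_convex_real[OF assms(1)])
  hence "(1 - t) *\<^sub>R (x, real_of_ereal (\<phi> x)) + t *\<^sub>R (y, real_of_ereal (\<phi> y)) \<in> epi \<phi>"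
    using cvx t by (intro convexD) auto
  hence le: "\<phi> ((1 - t) * x + t * y) \<le> ereal ((1 - t) * real_of_ereal (\<phi> x) + t * real_of_ereal (\<phi> y))"
    by (simp add: epi_def)
  thus fin: "\<phi> ((1 - t) * x + t * y) \<noteq> \<infinity>" by auto
  have "\<phi> ((1 - t) * x + t * y) = ereal (real_of_ereal (\<phi> ((1 - t) * x + t * y)))"
    using fin by (simp add: proper_closed_convex_real[OF assms(1)])
  with le show "real_of_ereal (\<phi> ((1 - t) * x + t * y)) \<le> (1 - t) * real_of_ereal (\<phi> x) + t * real_of_ereal (\<phi> y)"
    by (metis ereal_less_eq(3))
qed

text \<open>The problem is lifted to the epigraph, where the objective \<open>q\<close> is
  continuous and the constraint set closed. This replaces lower semicontinuity of
  \<open>\<phi>\<close>. The affine minorant lets the quadratic term dominate, so sublevel sets are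
  compact.\<close>

lemma scalar_prox_attained:
  assumes \<phi>: "proper_closed_convex \<phi>" and minor: "\<And>x. ereal (b + s * x) \<le> \<phi> x" and \<tau>: "\<tau> > 0"
  obtains p where "\<phi> p \<noteq> \<infinity>"
    and "\<And>x. \<phi> x \<noteq> \<infinity> \<Longrightarrow>
      (p - a)\<^sup>2 / 2 + \<tau> * real_of_ereal (\<phi> p) \<le> (x - a)\<^sup>2 / 2 + \<tau> * real_of_ereal (\<phi> x)"
proof -
  have nM: "\<And>z. \<phi> z \<noteq> - \<infinity>" and clo: "closed (epi \<phi>)"
    using \<phi> by (auto simp: proper_closed_convex_def)
  have mem: "(x, real_of_ereal (\<phi> x)) \<in> epi \<phi>" if "\<phi> x \<noteq> \<infinity>" for x
    using that by (simp add: epi_def proper_closed_convex_real[OF \<phi>])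
  obtain x1 where x1: "\<phi> x1 \<noteq> \<infinity>" using \<phi> by (auto simp: proper_closed_convex_def)
  define q where "q = (\<lambda>z :: real \<times> real. (fst z - a)\<^sup>2 / 2 + \<tau> * snd z)"
  define K where "K = q (x1, real_of_ereal (\<phi> x1))"
  define C where "C = epi \<phi> \<inter> {z. q z \<le> K}"
  have contq: "continuous_on S q" for S unfolding q_def by (intro continuous_intros) auto
  have "closed C" unfolding C_def using clo contq
    by (intro closed_Int closed_Collect_le continuous_on_const) auto
  moreover have "bounded C"
  proof -
    \<comment> \<open>Completing the square in \<open>(x - a)^2 / 2 + \<tau> * s * x\<close> gives
      the center \<open>c\<close>. The 1 in \<open>R\<close> ensures \<open>R \<ge> 1\<close>, so
      \<open>R - 1 \<le> R^2\<close> and no square root is needed.\<close>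
    define c where "c = a - \<tau> * s"
    define R where "R = \<bar>2 * (K - \<tau> * b - \<tau> * s * a + (\<tau> * s)\<^sup>2 / 2)\<bar> + 1"
    define T where "T = \<bar>b\<bar> + \<bar>s\<bar> * (\<bar>c\<bar> + R)"
    have "z \<in> {c - R..c + R} \<times> {- T..K / \<tau>}" if "z \<in> C" for z
    proof -
      obtain x t where z: "z = (x, t)" by force
      have "\<phi> x \<le> ereal t" and qz: "(x - a)\<^sup>2 / 2 + \<tau> * t \<le> K"
        using that by (auto simp: C_def z epi_def q_def)
      with minor[of x] have t: "b + s * x \<le> t" using order_trans by fastforce
      have "\<tau> * (b + s * x) \<le> \<tau> * t" using t \<tau> by simp
      with qz have "(x - a)\<^sup>2 / 2 + \<tau> * (b + s * x) \<le> K" by linarith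
      hence "(x - c)\<^sup>2 \<le> 2 * (K - \<tau> * b - \<tau> * s * a + (\<tau> * s)\<^sup>2 / 2)"
        by (simp add: c_def power2_eq_square field_simps)
      hence "\<bar>x - c\<bar>\<^sup>2 \<le> R - 1" by (simp add: R_def)
      also have "\<dots> \<le> R\<^sup>2"
      proof -
        have "R \<ge> 1" by (simp add: R_def)
        hence "R * 1 \<le> R * R" by (intro mult_left_mono) auto
        thus ?thesis by (simp add: power2_eq_square)
      qed
      finally have xc: "\<bar>x - c\<bar> \<le> R" by (rule power2_le_imp_le) (simp add: R_def)
      have "\<bar>s * x\<bar> \<le> \<bar>s\<bar> * (\<bar>c\<bar> + R)" using xc by (auto simp: abs_mult intro!: mult_left_mono)
      with t have "- T \<le> t" by (simp add: T_def)
      moreover have "\<tau> * t \<le> K" using qz zero_le_power2[of "x - a"] by linarith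
      hence "t \<le> K / \<tau>" using \<tau> by (simp add: field_simps)
      ultimately show ?thesis using xc by (auto simp: z abs_le_iff)
    qed
    moreover have "bounded ({c - R..c + R} \<times> {- T..K / \<tau>})" by (simp add: bounded_Times)
    ultimately show ?thesis by (meson bounded_subset subsetI)
  qed
  ultimately have "compact C" by (simp add: compact_eq_bounded_closed)
  moreover have "(x1, real_of_ereal (\<phi> x1)) \<in> C" using mem[OF x1] by (simp add: C_def K_def)
  ultimately obtain z0 where z0: "z0 \<in> C" "\<And>z. z \<in> C \<Longrightarrow> q z0 \<le> q z"
    using continuous_attains_inf[OF _ _ contq, of C] by blast
  obtain p t0 where p: "z0 = (p, t0)" by force
  have "\<phi> p \<le> ereal t0" using z0(1) by (simp add: p C_def epi_def)
  hence pfin: "\<phi> p \<noteq> \<infinity>" by auto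
  \<comment> \<open>A minimizer found in the epigraph can be moved down onto the graph without
    increasing \<open>q\<close>.\<close>
  hence "real_of_ereal (\<phi> p) \<le> t0" using \<open>\<phi> p \<le> ereal t0\<close> nM[of p] by (cases "\<phi> p") auto
  hence qp: "q (p, real_of_ereal (\<phi> p)) \<le> q z0" using \<tau> by (simp add: q_def p)
  show thesis
  proof (rule that[OF pfin])
    fix x assume x: "\<phi> x \<noteq> \<infinity>"
    have "q z0 \<le> q (x, real_of_ereal (\<phi> x))"
    proof (cases "(x, real_of_ereal (\<phi> x)) \<in> C")
      case False
      hence "K < q (x, real_of_ereal (\<phi> x))" using mem[OF x] by (simp add: C_def not_le)
      moreover have "q z0 \<le> K" using z0(1) by (simp add: C_def)
      ultimately show ?thesis by simp
    qed (rule z0(2))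
    with qp show "(p - a)\<^sup>2 / 2 + \<tau> * real_of_ereal (\<phi> p) \<le> (x - a)\<^sup>2 / 2 + \<tau> * real_of_ereal (\<phi> x)"
      by (simp add: q_def)
  qed
qed

text \<open>The proximal objective is a sum over coordinates, so scalar minimizers assemble to a
  minimizer, and \<open>env\<close> is this objective divided by \<open>\<tau> * d\<close>. The two
  claims together say that \<open>prox_value\<close> is the minimum of \<open>env\<close> over
  points with finite \<open>\<phi>\<close>.\<close>

lemma prox_value_attained_and_le:
  fixes d :: nat and a :: rvec
  assumes \<phi>: "proper_closed_convex \<phi>" and minor: "\<And>x. ereal (b + s * x) \<le> \<phi> x" and \<tau>: "\<tau> > 0"
  defines "env \<equiv> \<lambda>x. (\<Sum>i<d. (a i - x i)\<^sup>2 / (2 * \<tau>) + real_of_ereal (\<phi> (x i))) / real d"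
  shows "\<exists>x. (\<forall>i<d. \<phi> (x i) \<noteq> \<infinity>) \<and> prox_value d \<tau> (separable_sum d \<phi>) a = env x"
    and "\<And>x. (\<forall>i<d. \<phi> (x i) \<noteq> \<infinity>) \<Longrightarrow> prox_value d \<tau> (separable_sum d \<phi>) a \<le> env x"
proof -
  define Ob where "Ob = (\<lambda>x. ereal ((vnorm d (\<lambda>i. x i - a i))\<^sup>2 / 2) + ereal \<tau> * separable_sum d \<phi> x)"
  have Ob_fin: "Ob x = ereal (\<Sum>i<d. (x i - a i)\<^sup>2 / 2 + \<tau> * real_of_ereal (\<phi> (x i)))"
    if "\<forall>i<d. \<phi> (x i) \<noteq> \<infinity>" for x
    using separable_sum_finite[OF \<phi>, of d x] that
    by (simp add: Ob_def vnorm_sq sum.distrib sum_distrib_left sum_divide_distrib)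
  have Ob_inf: "Ob x = \<infinity>" if "\<not> (\<forall>i<d. \<phi> (x i) \<noteq> \<infinity>)" for x
    using that \<tau> separable_sum_eq_PInf_iff[of d \<phi> x] by (auto simp: Ob_def)
  have "\<exists>p. \<phi> p \<noteq> \<infinity> \<and> (\<forall>x. \<phi> x \<noteq> \<infinity> \<longrightarrow>
      (p - c)\<^sup>2 / 2 + \<tau> * real_of_ereal (\<phi> p) \<le> (x - c)\<^sup>2 / 2 + \<tau> * real_of_ereal (\<phi> x))" for c
    using scalar_prox_attained[OF \<phi> minor \<tau>, of c] by metis
  then obtain P where P: "\<And>c. \<phi> (P c) \<noteq> \<infinity>"
    "\<And>c x. \<phi> x \<noteq> \<infinity> \<Longrightarrow> (P c - c)\<^sup>2 / 2 + \<tau> * real_of_ereal (\<phi> (P c)) \<le> (x - c)\<^sup>2 / 2 + \<tau> * real_of_ereal (\<phi> x)"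
    by metis
  \<comment> \<open>An explicit minimizer shows that the \<open>arg_min\<close> in
    \<open>prox\<close> really selects one; the selected \<open>A\<close> is then compared with
    arbitrary points, including non-extensional ones.\<close>
  define Q where "Q = (\<lambda>i\<in>{..<d}. P (a i))"
  have Qfin: "\<forall>i<d. \<phi> (Q i) \<noteq> \<infinity>" using P(1) by (simp add: Q_def)
  have Qmin: "Ob Q \<le> Ob x" for x
  proof (cases "\<forall>i<d. \<phi> (x i) \<noteq> \<infinity>")
    case True
    thus ?thesis unfolding Ob_fin[OF Qfin] Ob_fin[OF True]
      using P(2) by (auto intro!: sum_mono simp: Q_def)
  qed (use Ob_inf in auto)
  define A where "A = prox d \<tau> (separable_sum d \<phi>) a"
  have "is_arg_min Ob (\<lambda>x. x \<in> extensional {..<d}) Q"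
    using Qmin by (auto simp: is_arg_min_def Q_def not_less)
  hence "is_arg_min Ob (\<lambda>x. x \<in> extensional {..<d}) A"
    unfolding A_def prox_def Ob_def[symmetric] arg_min_def
    by (rule someI[where P="is_arg_min Ob (\<lambda>x. x \<in> extensional {..<d})"])
  hence "Ob A \<le> Ob Q" by (auto simp: is_arg_min_def Q_def not_less)
  hence Amin: "Ob A \<le> Ob x" for x using Qmin order_trans by blast
  have Afin: "\<forall>i<d. \<phi> (A i) \<noteq> \<infinity>"
  proof (rule ccontr)
    assume "\<not> ?thesis"
    from Ob_inf[OF this] Amin[of Q] Ob_fin[OF Qfin] show False by simp
  qed
  have val: "prox_value d \<tau> (separable_sum d \<phi>) a = env A"
    unfolding prox_value_def A_def[symmetric] using separable_sum_finite[OF \<phi>, of d A] Afin \<tau>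
    by (simp add: vnorm_sq env_def sum.distrib sum_divide_distrib)
  show "\<exists>x. (\<forall>i<d. \<phi> (x i) \<noteq> \<infinity>) \<and> prox_value d \<tau> (separable_sum d \<phi>) a = env x"
    using Afin val by blast
  fix x assume x: "\<forall>i<d. \<phi> (x i) \<noteq> \<infinity>"
  have env_Ob: "env z = (\<Sum>i<d. (z i - a i)\<^sup>2 / 2 + \<tau> * real_of_ereal (\<phi> (z i))) / (\<tau> * real d)" for z
  proof -
    have "(\<Sum>i<d. (a i - z i)\<^sup>2 / (2 * \<tau>) + real_of_ereal (\<phi> (z i)))
        = (\<Sum>i<d. ((z i - a i)\<^sup>2 / 2 + \<tau> * real_of_ereal (\<phi> (z i))) / \<tau>)"
      using \<tau> by (intro sum.cong) (auto simp: field_simps power2_commute)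
    thus ?thesis by (simp add: env_def sum_divide_distrib[symmetric])
  qed
  show "prox_value d \<tau> (separable_sum d \<phi>) a \<le> env x"
    unfolding val env_Ob using Amin[of x] \<tau> unfolding Ob_fin[OF Afin] Ob_fin[OF x]
    by (intro divide_right_mono) auto
qed

text \<open>Changing a single coordinate in the subgradient inequality isolates its scalar part. The
  last claim provides the affine minorant required for attainment of proximal minima.\<close>

lemma subdifferential_separable_sum:
  assumes \<phi>: "proper_closed_convex \<phi>" and s: "s \<in> subdifferential d (separable_sum d \<phi>) x" and j: "j < d"
  shows "\<phi> (x j) \<noteq> \<infinity>" and "\<phi> z \<noteq> \<infinity> \<Longrightarrow> real_of_ereal (\<phi> (x j)) + s j * (z - x j) \<le> real_of_ereal (\<phi> z)"
    and "ereal (real_of_ereal (\<phi> (x j)) - s j * x j + s j * z) \<le> \<phi> z"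
proof -
  have sub: "separable_sum d \<phi> x + ereal (vdot d s (\<lambda>i. z i - x i)) \<le> separable_sum d \<phi> z" for z
    using s by (auto simp: subdifferential_def)
  obtain x1 where "\<phi> x1 \<noteq> \<infinity>" using \<phi> by (auto simp: proper_closed_convex_def)
  hence "separable_sum d \<phi> (\<lambda>_. x1) \<noteq> \<infinity>" by (simp add: separable_sum_eq_PInf_iff)
  hence "separable_sum d \<phi> x \<noteq> \<infinity>" using sub[of "\<lambda>_. x1"] by auto
  hence xfin: "\<phi> (x i) \<noteq> \<infinity>" if "i < d" for i using that by (auto simp: separable_sum_eq_PInf_iff)
  show "\<phi> (x j) \<noteq> \<infinity>" using xfin j .
  show ineq: "real_of_ereal (\<phi> (x j)) + s j * (z - x j) \<le> real_of_ereal (\<phi> z)" if z: "\<phi> z \<noteq> \<infinity>" for z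
  proof -
    define y where "y = x(j := z)"
    have yfin: "\<phi> (y i) \<noteq> \<infinity>" if "i < d" for i using xfin z that by (simp add: y_def)
    have split: "(\<Sum>i<d. F i) = F j + (\<Sum>i\<in>{..<d}-{j}. F i)" for F :: "nat \<Rightarrow> real"
      using j by (intro sum.remove) auto
    have 1: "vdot d s (\<lambda>i. y i - x i) = s j * (z - x j)"
      unfolding vdot_def split by (simp add: y_def)
    have "(\<Sum>i<d. real_of_ereal (\<phi> (x i))) + vdot d s (\<lambda>i. y i - x i) \<le> (\<Sum>i<d. real_of_ereal (\<phi> (y i)))"
      using sub[of y] separable_sum_finite[OF \<phi> xfin, of d] separable_sum_finite[OF \<phi> yfin, of d] by simp
    thus ?thesis unfolding 1 split by (simp add: y_def)
  qed
  show "ereal (real_of_ereal (\<phi> (x j)) - s j * x j + s j * z) \<le> \<phi> z"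
  proof (cases "\<phi> z = \<infinity>")
    case False
    hence "\<phi> z = ereal (real_of_ereal (\<phi> z))" using \<phi> by (simp add: proper_closed_convex_real)
    thus ?thesis using ineq[OF False] by (metis add.commute add_diff_eq diff_add_eq ereal_less_eq(3) right_diff_distrib)
  qed simp
qed

subsection \<open>Scalarization of the auxiliary optimization\<close>

text \<open>Joint convexity of the perspective of the square, from the identity
  \<open>(a p^2 + b q^2) (a + b) - (a p + b q)^2 = a b (p - q)^2\<close>.\<close>

lemma quad_over_linear_convex:
  fixes s1 s2 t v1 v2 :: real
  assumes "s1 > 0" "s2 > 0" "0 \<le> t" "t \<le> 1"
  shows "((1 - t) * v1 + t * v2)\<^sup>2 / ((1 - t) * s1 + t * s2) \<le> (1 - t) * (v1\<^sup>2 / s1) + t * (v2\<^sup>2 / s2)"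
proof -
  define a b where "a = (1 - t) * s1" and "b = t * s2"
  define p q where "p = v1 / s1" and "q = v2 / s2"
  have ab: "a \<ge> 0" "b \<ge> 0" using assms by (auto simp: a_def b_def)
  have "a + b > 0"
    using assms by (cases "t = 0") (auto simp: a_def b_def intro!: add_nonneg_pos)
  have v: "(1 - t) * v1 + t * v2 = a * p + b * q" "(1 - t) * (v1\<^sup>2 / s1) + t * (v2\<^sup>2 / s2) = a * p\<^sup>2 + b * q\<^sup>2"
    using assms by (auto simp: a_def b_def p_def q_def power2_eq_square)
  have "(a * p\<^sup>2 + b * q\<^sup>2) * (a + b) - (a * p + b * q)\<^sup>2 = a * b * (p - q)\<^sup>2"
    by (simp add: power2_eq_square algebra_simps)
  also have "\<dots> \<ge> 0" using ab by simp
  finally have "(a * p + b * q)\<^sup>2 \<le> (a * p\<^sup>2 + b * q\<^sup>2) * (a + b)" by simp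
  thus ?thesis using \<open>a + b > 0\<close> unfolding v by (simp add: a_def b_def divide_le_eq)
qed

lemma young_weighted:
  fixes a c v u :: real
  assumes "c > 0"
  shows "u * v \<le> c * v\<^sup>2 / 2 + u\<^sup>2 / (2 * c)"
proof -
  have "c * v\<^sup>2 / 2 + u\<^sup>2 / (2 * c) - u * v = (c * v - u)\<^sup>2 / (2 * c)"
    using assms by (simp add: power2_eq_square field_simps)
  also have "\<dots> \<ge> 0" using assms by simp
  finally show ?thesis by simp
qed

definition pos2 :: "(real \<times> real) set" where "pos2 = {0<..} \<times> {0<..}"

lemma convex_pos2: "convex pos2"
  unfolding pos2_def by (intro convex_Times) auto

text \<open>The finite-dimensional counterpart of \<^const>\<open>D_gen\<close>. The factor \<open>\<parallel>h\<parallel>\<^sup>2 / n\<close>, whose limit is \<open>1\<close>, makes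
  this exactly a partial minimum over \<open>(e, r)\<close>, hence exactly convex-concave; without it concavity in
  \<open>(\<beta>, \<tau>\<^sub>h)\<close> would only hold in the limit.\<close>

definition AO_value ::
  "nat \<Rightarrow> nat \<Rightarrow> real \<Rightarrow> real \<Rightarrow> (real \<Rightarrow> ereal) \<Rightarrow> (real \<Rightarrow> ereal) \<Rightarrow> rvec \<Rightarrow> rvec \<Rightarrow> rvec \<Rightarrow> rvec \<Rightarrow>
   real \<times> real \<Rightarrow> real \<times> real \<Rightarrow> real" where
  "AO_value m n \<delta> lam loss f g h x0 w = (\<lambda>(\<sigma>, \<tau>g) (\<beta>, \<tau>h).
     real m / real n * (\<beta> * \<tau>g / 2)
     + real m / real n * prox_value m (\<tau>g / \<beta>) (separable_sum m loss) (\<lambda>i. \<sigma> * g i + w i)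
     - real m / real n * (\<sigma> * \<tau>h / (2 * sqrt \<delta>))
     + lam * prox_value n (\<sigma> * sqrt \<delta> * lam / \<tau>h) (separable_sum n f)
               (\<lambda>j. x0 j + \<sigma> * sqrt \<delta> * \<beta> / \<tau>h * h j)
     - \<sigma> * sqrt \<delta> * \<beta>\<^sup>2 / (2 * \<tau>h) * (vdot n h h / real n))"

text \<open>One realization of the random vectors. In the application the affine minorants come from
  the subgradients at the matched solution.\<close>

locale scalarized_AO =
  fixes m n :: nat and \<delta> lam :: real and loss f :: "real \<Rightarrow> ereal" and g h x0 w :: rvec
  assumes dims: "m > 0" "n > 0" and pos: "\<delta> > 0" "lam > 0"
    and loss: "proper_closed_convex loss" "\<exists>b s. \<forall>x. ereal (b + s * x) \<le> loss x"
    and f: "proper_closed_convex f" "\<exists>b s. \<forall>x. ereal (b + s * x) \<le> f x"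
begin

abbreviation "rloss x \<equiv> real_of_ereal (loss x)"
abbreviation "rf x \<equiv> real_of_ereal (f x)"

definition feasible :: "rvec \<Rightarrow> rvec \<Rightarrow> bool" where
  "feasible e r \<longleftrightarrow> (\<forall>i<m. loss (r i) \<noteq> \<infinity>) \<and> (\<forall>j<n. f (x0 j + e j) \<noteq> \<infinity>)"

text \<open>Affine in \<open>(\<beta>, \<tau>\<^sub>h)\<close> and, apart from the convex terms in \<open>(e, r)\<close>, a sum of quadratic-over-linear
  terms in \<open>((e, r), (\<sigma>, \<tau>\<^sub>g))\<close>.\<close>

definition lagr :: "rvec \<Rightarrow> rvec \<Rightarrow> real \<times> real \<Rightarrow> real \<times> real \<Rightarrow> real" where
  "lagr e r = (\<lambda>(\<sigma>, \<tau>g) (\<beta>, \<tau>h).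
     (\<beta> * (real m * \<tau>g / 2 + (\<Sum>i<m. (\<sigma> * g i + w i - r i)\<^sup>2 / \<tau>g) / 2 - (\<Sum>j<n. h j * e j))
      + \<tau>h / sqrt \<delta> * ((\<Sum>j<n. (e j)\<^sup>2 / \<sigma>) / 2 - real m * \<sigma> / 2)
      + ((\<Sum>i<m. rloss (r i)) + lam * (\<Sum>j<n. rf (x0 j + e j)))) / real n)"

abbreviation "val \<equiv> AO_value m n \<delta> lam loss f g h x0 w"

text \<open>Completing the square in each \<open>e j\<close> absorbs the linear term
  \<open>\<beta> * h j * e j\<close> into a shift of the center by \<open>c * h j\<close>, at the
  price of the term in \<open>vdot n h h\<close>. The minimization over \<open>(e, r)\<close> thus
  decouples into two proximal problems.\<close>

lemma lagr_eq_prox_objectives: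
  assumes "\<sigma> > 0" "\<tau>g > 0" "\<beta> > 0" "\<tau>h > 0"
  defines "c \<equiv> \<sigma> * sqrt \<delta> * \<beta> / \<tau>h"
  shows "lagr e r (\<sigma>, \<tau>g) (\<beta>, \<tau>h) =
     real m / real n * (\<beta> * \<tau>g / 2)
     + real m / real n * ((\<Sum>i<m. (\<sigma> * g i + w i - r i)\<^sup>2 / (2 * (\<tau>g / \<beta>)) + rloss (r i)) / real m)
     - real m / real n * (\<sigma> * \<tau>h / (2 * sqrt \<delta>))
     + lam * ((\<Sum>j<n. (x0 j + c * h j - (x0 j + e j))\<^sup>2 / (2 * (\<sigma> * sqrt \<delta> * lam / \<tau>h)) + rf (x0 j + e j)) / real n)
     - \<sigma> * sqrt \<delta> * \<beta>\<^sup>2 / (2 * \<tau>h) * (vdot n h h / real n)"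
proof -
  have sd: "sqrt \<delta> > 0" using pos by simp
  have 1: "(\<Sum>i<m. (\<sigma> * g i + w i - r i)\<^sup>2 / (2 * (\<tau>g / \<beta>)) + rloss (r i))
      = \<beta> * ((\<Sum>i<m. (\<sigma> * g i + w i - r i)\<^sup>2 / \<tau>g) / 2) + (\<Sum>i<m. rloss (r i))"
    using assms by (simp add: sum.distrib sum_distrib_left sum_divide_distrib mult.commute)
  have "(x0 j + c * h j - (x0 j + e j))\<^sup>2 / (2 * (\<sigma> * sqrt \<delta> * lam / \<tau>h)) =
     (\<tau>h / sqrt \<delta> / 2 * ((e j)\<^sup>2 / \<sigma>) - \<beta> * (h j * e j) + \<sigma> * sqrt \<delta> * \<beta>\<^sup>2 / (2 * \<tau>h) * (h j * h j)) / lam" for j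
    unfolding c_def using assms(1-4) sd pos by (simp add: field_simps power2_eq_square)
  hence 3: "lam * ((x0 j + c * h j - (x0 j + e j))\<^sup>2 / (2 * (\<sigma> * sqrt \<delta> * lam / \<tau>h)) + rf (x0 j + e j)) =
     \<tau>h / sqrt \<delta> / 2 * ((e j)\<^sup>2 / \<sigma>) - \<beta> * (h j * e j) + \<sigma> * sqrt \<delta> * \<beta>\<^sup>2 / (2 * \<tau>h) * (h j * h j)
     + lam * rf (x0 j + e j)" for j
    using pos by (simp only: distrib_left) simp
  have 2: "lam * (\<Sum>j<n. (x0 j + c * h j - (x0 j + e j))\<^sup>2 / (2 * (\<sigma> * sqrt \<delta> * lam / \<tau>h)) + rf (x0 j + e j))
    = \<tau>h / sqrt \<delta> / 2 * (\<Sum>j<n. (e j)\<^sup>2 / \<sigma>) - \<beta> * (\<Sum>j<n. h j * e j)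
      + \<sigma> * sqrt \<delta> * \<beta>\<^sup>2 / (2 * \<tau>h) * vdot n h h + lam * (\<Sum>j<n. rf (x0 j + e j))"
    by (simp only: sum_distrib_left 3 vdot_def) (simp only: sum.distrib sum_subtractf)
  have mn: "real m / real n * (X / real m) = X / real n" for X using dims by simp
  have ln: "lam * (X / real n) = lam * X / real n" for X by simp
  show ?thesis unfolding lagr_def prod.case 1 mn ln
    unfolding 2 by (simp add: add_divide_distrib diff_divide_distrib distrib_left right_diff_distrib ac_simps)
qed

text \<open>With \<open>val_attained\<close> this identifies \<open>val\<close> as the minimum of
  \<open>lagr\<close> over feasible pairs, from which convexity, concavity and the saddle inequality
  are all derived.\<close>

lemma val_le_lagr:
  assumes "feasible e r" "x \<in> pos2" "y \<in> pos2"
  shows "val x y \<le> lagr e r x y"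
proof -
  obtain \<sigma> \<tau>g \<beta> \<tau>h where xy: "x = (\<sigma>, \<tau>g)" "y = (\<beta>, \<tau>h)" "\<sigma> > 0" "\<tau>g > 0" "\<beta> > 0" "\<tau>h > 0"
    using assms(2,3) by (auto simp: pos2_def)
  obtain bl sl bf sf where "\<And>x. ereal (bl + sl * x) \<le> loss x" "\<And>x. ereal (bf + sf * x) \<le> f x"
    using loss(2) f(2) by blast
  note L = prox_value_attained_and_le(2)[OF loss(1) this(1)]
    and F = prox_value_attained_and_le(2)[OF f(1) this(2)]
  show ?thesis
    unfolding xy(1,2) lagr_eq_prox_objectives[OF xy(3-6)] AO_value_def prod.case
    using assms(1) dims pos xy
    by (intro add_mono diff_right_mono mult_left_mono L F) (auto simp: feasible_def)
qed

lemma val_attained: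
  assumes "x \<in> pos2" "y \<in> pos2"
  obtains e r where "feasible e r" "val x y = lagr e r x y"
proof -
  obtain \<sigma> \<tau>g \<beta> \<tau>h where xy: "x = (\<sigma>, \<tau>g)" "y = (\<beta>, \<tau>h)" "\<sigma> > 0" "\<tau>g > 0" "\<beta> > 0" "\<tau>h > 0"
    using assms by (auto simp: pos2_def)
  obtain bl sl bf sf where b: "\<And>x. ereal (bl + sl * x) \<le> loss x" "\<And>x. ereal (bf + sf * x) \<le> f x"
    using loss(2) f(2) by blast
  obtain r where r: "\<forall>i<m. loss (r i) \<noteq> \<infinity>"
    "prox_value m (\<tau>g / \<beta>) (separable_sum m loss) (\<lambda>i. \<sigma> * g i + w i)
      = (\<Sum>i<m. (\<sigma> * g i + w i - r i)\<^sup>2 / (2 * (\<tau>g / \<beta>)) + rloss (r i)) / real m"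
    using prox_value_attained_and_le(1)[OF loss(1) b(1), of "\<tau>g / \<beta>" m "\<lambda>i. \<sigma> * g i + w i"] xy by auto
  obtain z where z: "\<forall>j<n. f (z j) \<noteq> \<infinity>"
    "prox_value n (\<sigma> * sqrt \<delta> * lam / \<tau>h) (separable_sum n f) (\<lambda>j. x0 j + \<sigma> * sqrt \<delta> * \<beta> / \<tau>h * h j)
      = (\<Sum>j<n. (x0 j + \<sigma> * sqrt \<delta> * \<beta> / \<tau>h * h j - z j)\<^sup>2 / (2 * (\<sigma> * sqrt \<delta> * lam / \<tau>h)) + rf (z j)) / real n"
    using prox_value_attained_and_le(1)[OF f(1) b(2), of "\<sigma> * sqrt \<delta> * lam / \<tau>h" n
        "\<lambda>j. x0 j + \<sigma> * sqrt \<delta> * \<beta> / \<tau>h * h j"] xy pos by auto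
  show thesis
  proof (rule that[of "\<lambda>j. z j - x0 j" r])
    show "feasible (\<lambda>j. z j - x0 j) r" using r z by (simp add: feasible_def)
    show "val x y = lagr (\<lambda>j. z j - x0 j) r x y"
      unfolding xy(1,2) lagr_eq_prox_objectives[OF xy(3-6)] AO_value_def prod.case r(2) z(2) by simp
  qed
qed

lemma feasible_combination:
  assumes "feasible e1 r1" "feasible e2 r2" "0 \<le> t" "t \<le> 1"
  shows "feasible (\<lambda>j. (1 - t) * e1 j + t * e2 j) (\<lambda>i. (1 - t) * r1 i + t * r2 i)"
proof -
  have "x0 j + ((1 - t) * e1 j + t * e2 j) = (1 - t) * (x0 j + e1 j) + t * (x0 j + e2 j)" for j
    by (simp add: algebra_simps)
  thus ?thesis using assms proper_closed_convex_combination(1)[OF loss(1)]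
      proper_closed_convex_combination(1)[OF f(1)] by (simp add: feasible_def)
qed

text \<open>Joint convexity in \<open>(e, r)\<close> and \<open>(\<sigma>, \<tau>g)\<close> for
  fixed \<open>y\<close>: the brackets multiplied by \<open>\<beta>\<close> and
  \<open>\<tau>h / sqrt \<delta>\<close> are convex and these factors are nonnegative.\<close>

lemma lagr_convex:
  assumes fe: "feasible e1 r1" "feasible e2 r2" and t: "0 \<le> t" "t \<le> 1"
    and x: "x1 \<in> pos2" "x2 \<in> pos2" and y: "y \<in> pos2"
  shows "lagr (\<lambda>j. (1 - t) * e1 j + t * e2 j) (\<lambda>i. (1 - t) * r1 i + t * r2 i) ((1 - t) *\<^sub>R x1 + t *\<^sub>R x2) y
         \<le> (1 - t) * lagr e1 r1 x1 y + t * lagr e2 r2 x2 y"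
proof -
  obtain \<sigma>1 \<tau>1 \<sigma>2 \<tau>2 \<beta> \<tau>h where xy: "x1 = (\<sigma>1, \<tau>1)" "x2 = (\<sigma>2, \<tau>2)" "y = (\<beta>, \<tau>h)"
    "\<sigma>1 > 0" "\<tau>1 > 0" "\<sigma>2 > 0" "\<tau>2 > 0" "\<beta> > 0" "\<tau>h > 0"
    using x y by (auto simp: pos2_def)
  define e where "e = (\<lambda>j. (1 - t) * e1 j + t * e2 j)"
  define r where "r = (\<lambda>i. (1 - t) * r1 i + t * r2 i)"
  define \<sigma> \<tau> where "\<sigma> = (1 - t) * \<sigma>1 + t * \<sigma>2" and "\<tau> = (1 - t) * \<tau>1 + t * \<tau>2"
  have comb: "(\<Sum>i\<in>I. (1 - t) * a i + t * b i) = (1 - t) * sum a I + t * sum b I" for a b :: "nat \<Rightarrow> real" and I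
    by (simp add: sum.distrib sum_distrib_left)
  have 1: "(\<Sum>i<m. (\<sigma> * g i + w i - r i)\<^sup>2 / \<tau>)
      \<le> (1 - t) * (\<Sum>i<m. (\<sigma>1 * g i + w i - r1 i)\<^sup>2 / \<tau>1) + t * (\<Sum>i<m. (\<sigma>2 * g i + w i - r2 i)\<^sup>2 / \<tau>2)"
    unfolding comb[symmetric]
  proof (rule sum_mono)
    fix i
    have "\<sigma> * g i + w i - r i = (1 - t) * (\<sigma>1 * g i + w i - r1 i) + t * (\<sigma>2 * g i + w i - r2 i)"
      by (simp add: \<sigma>_def r_def algebra_simps)
    thus "(\<sigma> * g i + w i - r i)\<^sup>2 / \<tau>
      \<le> (1 - t) * ((\<sigma>1 * g i + w i - r1 i)\<^sup>2 / \<tau>1) + t * ((\<sigma>2 * g i + w i - r2 i)\<^sup>2 / \<tau>2)"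
      unfolding \<tau>_def using quad_over_linear_convex xy(5,7) t by presburger
  qed
  have 2: "(\<Sum>j<n. (e j)\<^sup>2 / \<sigma>) \<le> (1 - t) * (\<Sum>j<n. (e1 j)\<^sup>2 / \<sigma>1) + t * (\<Sum>j<n. (e2 j)\<^sup>2 / \<sigma>2)"
    unfolding comb[symmetric] \<sigma>_def e_def using quad_over_linear_convex xy(4,6) t
    by (intro sum_mono) auto
  have 3: "(\<Sum>i<m. rloss (r i)) \<le> (1 - t) * (\<Sum>i<m. rloss (r1 i)) + t * (\<Sum>i<m. rloss (r2 i))"
    unfolding comb[symmetric] r_def using fe t
    by (intro sum_mono proper_closed_convex_combination(2)[OF loss(1)]) (auto simp: feasible_def)
  have 4: "(\<Sum>j<n. rf (x0 j + e j)) \<le> (1 - t) * (\<Sum>j<n. rf (x0 j + e1 j)) + t * (\<Sum>j<n. rf (x0 j + e2 j))"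
    unfolding comb[symmetric]
  proof (rule sum_mono)
    fix j assume "j \<in> {..<n}"
    moreover have "x0 j + e j = (1 - t) * (x0 j + e1 j) + t * (x0 j + e2 j)" by (simp add: e_def algebra_simps)
    ultimately show "rf (x0 j + e j) \<le> (1 - t) * rf (x0 j + e1 j) + t * rf (x0 j + e2 j)"
      using fe t proper_closed_convex_combination(2)[OF f(1)] by (auto simp: feasible_def)
  qed
  have 5: "(\<Sum>j<n. h j * e j) = (1 - t) * (\<Sum>j<n. h j * e1 j) + t * (\<Sum>j<n. h j * e2 j)"
    unfolding comb[symmetric] e_def by (intro sum.cong) (auto simp: algebra_simps)
  define A where "A = (\<lambda>\<sigma> \<tau> (r::rvec) (e::rvec). real m * \<tau> / 2 + (\<Sum>i<m. (\<sigma> * g i + w i - r i)\<^sup>2 / \<tau>) / 2 - (\<Sum>j<n. h j * e j))"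
  define B where "B = (\<lambda>\<sigma> (e::rvec). (\<Sum>j<n. (e j)\<^sup>2 / \<sigma>) / 2 - real m * \<sigma> / 2)"
  define C where "C = (\<lambda>(r::rvec) (e::rvec). (\<Sum>i<m. rloss (r i)) + lam * (\<Sum>j<n. rf (x0 j + e j)))"
  define q where "q = \<tau>h / sqrt \<delta>"
  have q: "q \<ge> 0" using xy pos by (simp add: q_def)
  have "A \<sigma> \<tau> r e \<le> (1 - t) * A \<sigma>1 \<tau>1 r1 e1 + t * A \<sigma>2 \<tau>2 r2 e2"
    using 1 unfolding A_def 5 by (simp add: \<tau>_def field_simps)
  hence "\<beta> * A \<sigma> \<tau> r e \<le> \<beta> * ((1 - t) * A \<sigma>1 \<tau>1 r1 e1 + t * A \<sigma>2 \<tau>2 r2 e2)" using xy by simp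
  moreover have "B \<sigma> e \<le> (1 - t) * B \<sigma>1 e1 + t * B \<sigma>2 e2"
    using 2 unfolding B_def by (simp add: \<sigma>_def field_simps)
  hence "q * B \<sigma> e \<le> q * ((1 - t) * B \<sigma>1 e1 + t * B \<sigma>2 e2)"
    using q by (intro mult_left_mono) auto
  moreover have "C r e \<le> (1 - t) * C r1 e1 + t * C r2 e2"
  proof -
    have "lam * (\<Sum>j<n. rf (x0 j + e j)) \<le> lam * ((1 - t) * (\<Sum>j<n. rf (x0 j + e1 j)) + t * (\<Sum>j<n. rf (x0 j + e2 j)))"
      using 4 pos by simp
    with 3 show ?thesis unfolding C_def by (simp add: algebra_simps)
  qed
  ultimately have "\<beta> * A \<sigma> \<tau> r e + q * B \<sigma> e + C r e
     \<le> (1 - t) * (\<beta> * A \<sigma>1 \<tau>1 r1 e1 + q * B \<sigma>1 e1 + C r1 e1)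
       + t * (\<beta> * A \<sigma>2 \<tau>2 r2 e2 + q * B \<sigma>2 e2 + C r2 e2)"
    by (simp add: algebra_simps)
  moreover have "((1 - t) * X + t * Y) / real n = (1 - t) * (X / real n) + t * (Y / real n)" for X Y
    by (simp add: add_divide_distrib)
  ultimately
  have "(\<beta> * A \<sigma> \<tau> r e + q * B \<sigma> e + C r e) / real n
     \<le> (1 - t) * ((\<beta> * A \<sigma>1 \<tau>1 r1 e1 + q * B \<sigma>1 e1 + C r1 e1) / real n)
       + t * ((\<beta> * A \<sigma>2 \<tau>2 r2 e2 + q * B \<sigma>2 e2 + C r2 e2) / real n)"
    using dims by (metis divide_right_mono of_nat_0_le_iff)
  thus ?thesis
    unfolding xy(1-3) lagr_def prod.case scaleR_Pair add_Pair real_scaleR_def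
      A_def B_def C_def q_def \<sigma>_def \<tau>_def e_def r_def .
qed

text \<open>Partial minimization of a jointly convex function preserves convexity.\<close>

lemma val_convex_on: "y \<in> pos2 \<Longrightarrow> convex_on pos2 (\<lambda>x. val x y)"
proof (rule convex_onI)
  fix t x1 x2 assume t: "0 < t" "t < (1::real)" and x: "x1 \<in> pos2" "x2 \<in> pos2" and y: "y \<in> pos2"
  obtain e1 r1 where 1: "feasible e1 r1" "val x1 y = lagr e1 r1 x1 y" using val_attained x y by blast
  obtain e2 r2 where 2: "feasible e2 r2" "val x2 y = lagr e2 r2 x2 y" using val_attained x y by blast
  have "(1 - t) *\<^sub>R x1 + t *\<^sub>R x2 \<in> pos2" using x t convex_pos2 by (intro convexD) auto
  hence "val ((1 - t) *\<^sub>R x1 + t *\<^sub>R x2) y \<le>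
    lagr (\<lambda>j. (1 - t) * e1 j + t * e2 j) (\<lambda>i. (1 - t) * r1 i + t * r2 i) ((1 - t) *\<^sub>R x1 + t *\<^sub>R x2) y"
    using 1 2 t y by (intro val_le_lagr feasible_combination) auto
  also have "\<dots> \<le> (1 - t) * val x1 y + t * val x2 y"
    unfolding 1 2 using 1 2 t x y by (intro lagr_convex) auto
  finally show "val ((1 - t) *\<^sub>R x1 + t *\<^sub>R x2) y \<le> (1 - t) * val x1 y + t * val x2 y" .
qed (rule convex_pos2)

lemma lagr_affine:
  "lagr e r x ((1 - t) *\<^sub>R y1 + t *\<^sub>R y2) = (1 - t) * lagr e r x y1 + t * lagr e r x y2"
proof (cases x, cases y1, cases y2)
  fix \<sigma> \<tau>g \<beta>1 \<tau>1 \<beta>2 \<tau>2 assume xy: "x = (\<sigma>, \<tau>g)" "y1 = (\<beta>1, \<tau>1)" "y2 = (\<beta>2, \<tau>2)"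
  have "(((1 - t) * \<beta>1 + t * \<beta>2) * A + ((1 - t) * \<tau>1 + t * \<tau>2) / q * B + C) / N
      = (1 - t) * ((\<beta>1 * A + \<tau>1 / q * B + C) / N) + t * ((\<beta>2 * A + \<tau>2 / q * B + C) / N)" for A B C q N
    by (simp add: algebra_simps add_divide_distrib diff_divide_distrib)
  thus ?thesis unfolding xy lagr_def prod.case scaleR_Pair add_Pair real_scaleR_def .
qed

text \<open>For fixed \<open>x\<close> the value is a minimum of functions affine in
  \<open>y\<close>.\<close>

lemma val_concave_on: "x \<in> pos2 \<Longrightarrow> concave_on pos2 (val x)"
  unfolding concave_on_def
proof (rule convex_onI)
  fix t y1 y2 assume t: "0 < t" "t < (1::real)" and y: "y1 \<in> pos2" "y2 \<in> pos2" and x: "x \<in> pos2"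
  have "(1 - t) *\<^sub>R y1 + t *\<^sub>R y2 \<in> pos2" using y t convex_pos2 by (intro convexD) auto
  then obtain e r where er: "feasible e r" "val x ((1 - t) *\<^sub>R y1 + t *\<^sub>R y2) = lagr e r x ((1 - t) *\<^sub>R y1 + t *\<^sub>R y2)"
    using val_attained x by blast
  have "(1 - t) * val x y1 \<le> (1 - t) * lagr e r x y1" "t * val x y2 \<le> t * lagr e r x y2"
    using val_le_lagr er x y t by auto
  thus "- val x ((1 - t) *\<^sub>R y1 + t *\<^sub>R y2) \<le> (1 - t) * - val x y1 + t * - val x y2"
    unfolding er lagr_affine by simp
qed (rule convex_pos2)

end

subsection \<open>KKT conditions\<close>

context scalarized_AO
begin

text \<open>Both sides are compared with the optimal value of the auxiliary optimization divided by \<open>n\<close>,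
  called \<open>V\<close> below.\<close>

lemma KKT_scalar_saddle:
  fixes \<sigma> \<beta> \<mu> \<kappa> :: real and e u r s :: rvec
  assumes sc: "\<sigma> > 0" "\<beta> > 0" "\<mu> > 0" "\<kappa> > 0"
    and fe: "feasible e r"
    and res: "\<And>i. i < m \<Longrightarrow> \<sigma> * g i + w i - r i = \<kappa> * u i"
    and subl: "\<And>i z. i < m \<Longrightarrow> loss z \<noteq> \<infinity> \<Longrightarrow> rloss (r i) + u i * (z - r i) \<le> rloss z"
    and subf: "\<And>j z. j < n \<Longrightarrow> f z \<noteq> \<infinity> \<Longrightarrow> rf (x0 j + e j) + s j * (z - (x0 j + e j)) \<le> rf z"
    and s: "\<And>j. j < n \<Longrightarrow> lam * s j = \<beta> * h j - \<mu> * e j"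
    and ee: "(\<Sum>j<n. (e j)\<^sup>2) = real m * \<sigma>\<^sup>2" and uu: "(\<Sum>i<m. (u i)\<^sup>2) = real m * \<beta>\<^sup>2"
    and gu: "(\<Sum>i<m. g i * u i) = real m * \<sigma> * \<mu>" and he: "(\<Sum>j<n. h j * e j) = real m * \<beta> * \<kappa>"
    and x: "x \<in> pos2" and y: "y \<in> pos2"
  shows "val (\<sigma>, \<kappa> * \<beta>) y \<le> val x (\<beta>, sqrt \<delta> * \<sigma> * \<mu>)"
proof -
  define V where "V = ((\<Sum>i<m. rloss (r i)) + lam * (\<Sum>j<n. rf (x0 j + e j))) / real n"
  have sd: "sqrt \<delta> > 0" using pos by simp
  have "val (\<sigma>, \<kappa> * \<beta>) y \<le> lagr e r (\<sigma>, \<kappa> * \<beta>) y"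
    using fe y sc by (intro val_le_lagr) (auto simp: pos2_def)
  \<comment> \<open>At the matched pair the brackets multiplying \<open>\<beta>\<close> and
    \<open>\<tau>h\<close> both vanish, so the value does not depend on \<open>y\<close>.\<close>
  also have "\<dots> = V"
  proof -
    have "(\<Sum>i<m. (\<sigma> * g i + w i - r i)\<^sup>2 / (\<kappa> * \<beta>)) = (\<Sum>i<m. \<kappa> / \<beta> * (u i)\<^sup>2)"
      using res sc by (intro sum.cong) (auto simp: power2_eq_square field_simps)
    also have "\<dots> = real m * \<kappa> * \<beta>"
      using sc unfolding sum_distrib_left[symmetric] uu by (simp add: power2_eq_square)
    finally have 1: "(\<Sum>i<m. (\<sigma> * g i + w i - r i)\<^sup>2 / (\<kappa> * \<beta>)) = real m * \<kappa> * \<beta>" .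
    have 2: "(\<Sum>j<n. (e j)\<^sup>2 / \<sigma>) = real m * \<sigma>"
      using sc unfolding sum_divide_distrib[symmetric] ee by (simp add: power2_eq_square)
    show ?thesis unfolding lagr_def V_def by (cases y) (simp add: 1 2 he)
  qed
  also have "V \<le> val x (\<beta>, sqrt \<delta> * \<sigma> * \<mu>)"
  proof -
    obtain c \<tau> where xc: "x = (c, \<tau>)" "c > 0" "\<tau> > 0" using x by (auto simp: pos2_def)
    have "(\<beta>, sqrt \<delta> * \<sigma> * \<mu>) \<in> pos2" using sc sd by (auto simp: pos2_def)
    then obtain e' r' where er: "feasible e' r'" "val x (\<beta>, sqrt \<delta> * \<sigma> * \<mu>) = lagr e' r' x (\<beta>, sqrt \<delta> * \<sigma> * \<mu>)"
      using val_attained x by blast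
    define v where "v = (\<lambda>i. c * g i + w i - r' i)"
    \<comment> \<open>Subgradient inequality for the loss, combined with Young's inequality of
      weight \<open>\<beta> / \<tau>\<close> for \<open>u i * v i\<close>.\<close>
    have "(\<Sum>i<m. (c - \<sigma>) * (g i * u i) + \<kappa> * (u i)\<^sup>2 - \<tau> / (2 * \<beta>) * (u i)\<^sup>2 + rloss (r i))
       \<le> (\<Sum>i<m. \<beta> / 2 * ((v i)\<^sup>2 / \<tau>) + rloss (r' i))"
    proof (rule sum_mono)
      fix i assume i: "i \<in> {..<m}"
      have "rloss (r i) + u i * (r' i - r i) \<le> rloss (r' i)"
        using subl[of i "r' i"] i er(1) by (simp add: feasible_def)
      moreover have "u i * v i \<le> \<beta> / 2 * ((v i)\<^sup>2 / \<tau>) + \<tau> / (2 * \<beta>) * (u i)\<^sup>2"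
        using young_weighted[of "\<beta> / \<tau>" "u i" "v i"] sc xc by (simp add: field_simps)
      moreover have "r' i - r i = (c - \<sigma>) * g i + \<kappa> * u i - v i"
        using res[of i] i by (simp add: v_def algebra_simps)
      hence "u i * (r' i - r i) = u i * ((c - \<sigma>) * g i + \<kappa> * u i - v i)" by simp
      hence "u i * (r' i - r i) = (c - \<sigma>) * (g i * u i) + \<kappa> * (u i)\<^sup>2 - u i * v i"
        by (simp add: power2_eq_square algebra_simps)
      ultimately show "(c - \<sigma>) * (g i * u i) + \<kappa> * (u i)\<^sup>2 - \<tau> / (2 * \<beta>) * (u i)\<^sup>2 + rloss (r i)
          \<le> \<beta> / 2 * ((v i)\<^sup>2 / \<tau>) + rloss (r' i)" by linarith
    qed
    hence 1: "(c - \<sigma>) * (real m * \<sigma> * \<mu>) + \<kappa> * (real m * \<beta>\<^sup>2) - \<tau> / (2 * \<beta>) * (real m * \<beta>\<^sup>2) + (\<Sum>i<m. rloss (r i))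
       \<le> \<beta> / 2 * (\<Sum>i<m. (v i)\<^sup>2 / \<tau>) + (\<Sum>i<m. rloss (r' i))"
      by (simp only: sum.distrib sum_subtractf sum_distrib_left[symmetric] gu uu)
    \<comment> \<open>The same for the regularizer: Young's inequality of weight
      \<open>\<sigma> / c\<close> bounds the cross term \<open>\<mu> * (e j * e' j)\<close>.\<close>
    have "(\<Sum>j<n. \<mu> * (e j)\<^sup>2 - \<mu> * c / (2 * \<sigma>) * (e j)\<^sup>2 - \<beta> * (h j * e j) + lam * rf (x0 j + e j))
       \<le> (\<Sum>j<n. \<sigma> * \<mu> / 2 * ((e' j)\<^sup>2 / c) - \<beta> * (h j * e' j) + lam * rf (x0 j + e' j))"
    proof (rule sum_mono)
      fix j assume j: "j \<in> {..<n}"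
      have "rf (x0 j + e j) + s j * (e' j - e j) \<le> rf (x0 j + e' j)"
        using subf[of j "x0 j + e' j"] j er(1) by (simp add: feasible_def)
      hence "lam * (rf (x0 j + e j) + s j * (e' j - e j)) \<le> lam * rf (x0 j + e' j)" using pos by simp
      moreover have "lam * (s j * (e' j - e j)) = (\<beta> * h j - \<mu> * e j) * (e' j - e j)"
        using s[of j] j by (metis lessThan_iff mult.assoc)
      moreover have "\<mu> * (e j * e' j) \<le> \<mu> * (\<sigma> / 2 * ((e' j)\<^sup>2 / c) + c / (2 * \<sigma>) * (e j)\<^sup>2)"
        using young_weighted[of "\<sigma> / c" "e j" "e' j"] sc xc by (intro mult_left_mono) (auto simp: field_simps)
      ultimately show "\<mu> * (e j)\<^sup>2 - \<mu> * c / (2 * \<sigma>) * (e j)\<^sup>2 - \<beta> * (h j * e j) + lam * rf (x0 j + e j)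
         \<le> \<sigma> * \<mu> / 2 * ((e' j)\<^sup>2 / c) - \<beta> * (h j * e' j) + lam * rf (x0 j + e' j)"
        by (simp add: algebra_simps power2_eq_square)
    qed
    hence 2: "\<mu> * (real m * \<sigma>\<^sup>2) - \<mu> * c / (2 * \<sigma>) * (real m * \<sigma>\<^sup>2) - \<beta> * (real m * \<beta> * \<kappa>) + lam * (\<Sum>j<n. rf (x0 j + e j))
       \<le> \<sigma> * \<mu> / 2 * (\<Sum>j<n. (e' j)\<^sup>2 / c) - \<beta> * (\<Sum>j<n. h j * e' j) + lam * (\<Sum>j<n. rf (x0 j + e' j))"
      by (simp only: sum.distrib sum_subtractf sum_distrib_left[symmetric] ee he)
    have L: "lagr e' r' x (\<beta>, sqrt \<delta> * \<sigma> * \<mu>) =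
       (\<beta> * (real m * \<tau> / 2 + (\<Sum>i<m. (v i)\<^sup>2 / \<tau>) / 2 - (\<Sum>j<n. h j * e' j))
        + \<sigma> * \<mu> * ((\<Sum>j<n. (e' j)\<^sup>2 / c) / 2 - real m * c / 2)
        + ((\<Sum>i<m. rloss (r' i)) + lam * (\<Sum>j<n. rf (x0 j + e' j)))) / real n"
      using sd pos by (simp add: lagr_def xc(1) v_def)
    have simps: "\<tau> / (2 * \<beta>) * (real m * \<beta>\<^sup>2) = \<beta> * (real m * \<tau> / 2)"
      "\<mu> * c / (2 * \<sigma>) * (real m * \<sigma>\<^sup>2) = \<sigma> * \<mu> * (real m * c / 2)"
      using sc by (auto simp: power2_eq_square)
    \<comment> \<open>Adding \<open>1\<close> and \<open>2\<close>, the terms in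
      \<open>\<kappa>\<close> and in \<open>\<mu> * \<sigma>^2\<close> cancel, and the remaining
      multiples of \<open>m\<close> are exactly those in \<open>lagr\<close>.\<close>
    show ?thesis unfolding er(2) L V_def
      using 1 2 unfolding simps by (intro divide_right_mono) (auto simp: algebra_simps power2_eq_square)
  qed
  finally show ?thesis .
qed

end

section \<open>Optimality in \<open>u\<close> and the matched solution\<close>

lemma vnorm_sq_vdot: "(vnorm d x)\<^sup>2 = vdot d x x"
  unfolding vnorm_sq vdot_def by (simp add: power2_eq_square)

lemma vnorm_nonneg: "vnorm d x \<ge> 0"
  by (simp add: vnorm_def)

text \<open>By homogeneity, comparing \<open>u\<close> with its multiples by 0 and 2 shows that the
  maximum is 0. Testing with \<open>q\<close> gives \<open>vnorm d q \<le> c\<close>, so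
  Cauchy-Schwarz is an equality for \<open>u\<close> and \<open>q\<close>, which makes them
  parallel.\<close>

lemma norm_penalized_linear_maximizer:
  assumes max: "\<And>v. vdot d v q - c * vnorm d v \<le> vdot d u q - c * vnorm d u"
    and u: "vnorm d u > 0" and c: "c \<ge> 0" and i: "i < d"
  shows "q i = c / vnorm d u * u i"
proof -
  define U where "U = vnorm d u"
  have scale: "vdot d (\<lambda>i. t * u i) q = t * vdot d u q" "t \<ge> 0 \<Longrightarrow> vnorm d (\<lambda>i. t * u i) = t * vnorm d u" for t
    by (auto simp: vdot_def vnorm_def sum_distrib_left L2_set_right_distrib mult.assoc)
  have uq: "vdot d u q = c * U"
    using max[of "\<lambda>i. 0 * u i"] max[of "\<lambda>i. 2 * u i"] unfolding scale(1) scale(2)[OF order_refl]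
    by (simp add: scale(2) U_def)
  have qq: "(vnorm d q)\<^sup>2 \<le> c * vnorm d q" using max[of q] uq by (simp add: U_def vnorm_sq_vdot)
  have "vnorm d q \<le> c"
  proof (cases "vnorm d q = 0")
    case False
    hence "vnorm d q > 0" using vnorm_nonneg[of d q] by simp
    thus ?thesis using qq by (simp add: power2_eq_square)
  qed (use c in simp)
  hence q2: "vdot d q q \<le> c\<^sup>2" unfolding vnorm_sq_vdot[symmetric] by (intro power_mono vnorm_nonneg)
  have "(\<Sum>i<d. (q i - c / U * u i)\<^sup>2) = vdot d q q - 2 * (c / U) * vdot d u q + (c / U)\<^sup>2 * vdot d u u"
    by (simp add: vdot_def power2_diff sum.distrib sum_subtractf sum_distrib_left power2_eq_square algebra_simps)
  also have "\<dots> = vdot d q q - c\<^sup>2"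
    using u unfolding uq vnorm_sq_vdot[symmetric] U_def[symmetric] by (simp add: power2_eq_square)
  finally have "(\<Sum>i<d. (q i - c / U * u i)\<^sup>2) \<le> 0" using q2 by simp
  moreover have "(\<Sum>i<d. (q i - c / U * u i)\<^sup>2) \<ge> 0" by (intro sum_nonneg) auto
  ultimately have "(\<Sum>i<d. (q i - c / U * u i)\<^sup>2) = 0" by simp
  hence "(q i - c / U * u i)\<^sup>2 = 0" using i by (subst (asm) sum_nonneg_eq_0_iff) auto
  thus ?thesis by (simp add: U_def)
qed

text \<open>The objective is affine in \<open>u\<close> with slope \<open>q\<close>; a maximum over
  the whole space forces \<open>q = 0\<close>, as the test vector \<open>u + q\<close>
  shows.\<close>

lemma PO_saddle_residual:
  assumes sp: "saddle_point (PO_objective m n L F lam A x0 w) UNIV UNIV (e, r) u"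
    and fin: "L r + ereal lam * F (\<lambda>j. x0 j + e j) = ereal c" and m: "m > 0" and i: "i < m"
  shows "r i = w i - mat_vec n A e i"
proof -
  define q where "q = (\<lambda>i. w i - mat_vec n A e i - r i)"
  have obj: "PO_objective m n L F lam A x0 w (e, r) v = ereal (vdot m v q + c)" for v
  proof -
    have "mat_vec n (\<lambda>i j. sqrt (real m) * A i j) e = (\<lambda>i. sqrt (real m) * mat_vec n A e i)"
      by (simp add: mat_vec_def sum_distrib_left mult.assoc)
    hence "- (1 / sqrt (real m)) * vdot m v (mat_vec n (\<lambda>i j. sqrt (real m) * A i j) e) + vdot m v w - vdot m v r = vdot m v q"
      using m by (simp add: vdot_def q_def sum_distrib_left sum_subtractf sum_negf sum.distrib right_diff_distrib mult.left_commute)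
    thus ?thesis unfolding PO_objective_def Let_def prod.case using fin
      by (simp add: add.assoc)
  qed
  have "vdot m (\<lambda>i. u i + q i) q \<le> vdot m u q"
    using sp unfolding saddle_point_def obj by simp
  hence "(\<Sum>i<m. q i * q i) \<le> 0" by (simp add: vdot_def distrib_right sum.distrib)
  moreover have "(\<Sum>i<m. q i * q i) \<ge> 0" by (intro sum_nonneg) auto
  ultimately have "q i * q i = 0" using i sum_nonneg_eq_0_iff[of "{..<m}" "\<lambda>i. q i * q i"] by simp
  thus ?thesis by (simp add: q_def)
qed

text \<open>As a function of \<open>u\<close> the objective is linear minus a multiple
  \<open>b\<close> of the norm. Positivity of \<open>kappa_hat\<close> gives \<open>b > 0\<close>
  and \<open>u \<noteq> 0\<close>, so the maximizer is parallel to \<open>q\<close>.\<close>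

lemma AO_saddle_residual:
  assumes sp: "saddle_point (AO_objective m n L F lam g h x0 w) UNIV UNIV (e, r) u"
    and fin: "L r + ereal lam * F (\<lambda>j. x0 j + e j) = ereal c" and m: "m > 0" and i: "i < m"
    and \<kappa>: "kappa_hat m n h e u > 0"
  shows "sigma_hat m n e * g i + w i - r i = kappa_hat m n h e u * u i"
proof -
  define q where "q = (\<lambda>i. sigma_hat m n e * g i + w i - r i)"
  define b where "b = vdot n h e / sqrt (real m)"
  have obj: "AO_objective m n L F lam g h x0 w (e, r) v = ereal (vdot m v q - b * vnorm m v + c)" for v
  proof -
    have "vdot m v q = sigma_hat m n e * vdot m g v + vdot m v w - vdot m v r"
      by (simp add: vdot_def q_def sum_distrib_left sum_subtractf sum.distrib algebra_simps)
    hence "vnorm n e / sqrt (real m) * vdot m g v - vnorm m v / sqrt (real m) * vdot n h e + vdot m v w - vdot m v r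
      = vdot m v q - b * vnorm m v"
      by (simp add: b_def sigma_hat_def)
    thus ?thesis unfolding AO_objective_def prod.case using fin by (simp add: add.assoc)
  qed
  have k: "kappa_hat m n h e u = b / vnorm m u"
  proof -
    have "real m * (vnorm m u / sqrt (real m)) = sqrt (real m) * vnorm m u"
      using real_div_sqrt[of "real m"] by (metis of_nat_0_le_iff times_divide_eq_left times_divide_eq_right)
    thus ?thesis by (simp add: kappa_hat_def beta_hat_def b_def)
  qed
  hence U: "vnorm m u > 0" "b > 0" using \<kappa> vnorm_nonneg[of m u] by (auto simp: zero_less_divide_iff)
  have "q i = b / vnorm m u * u i"
    using sp U i unfolding saddle_point_def obj by (intro norm_penalized_linear_maximizer) auto
  thus ?thesis by (simp add: k q_def)
qed

text \<open>The deterministic content of the theorem for one realization: both vector identities,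
  and the saddle point of the finite-dimensional value.\<close>

lemma matched_solution_scalars:
  assumes dims: "m > 0" "n > 0" and pos: "\<delta> > 0" "lam > 0"
    and loss_cvx: "proper_closed_convex loss" and f_cvx: "proper_closed_convex f"
    and matched: "matched_solution m n (separable_sum m loss) (separable_sum n f) lam A x0 w g h e u r"
    and sub: "common_subgradient m n (separable_sum m loss) (separable_sum n f) lam A x0 g h e u r"
    and \<kappa>: "kappa_hat m n h e u > 0" and \<mu>r: "mu_r_hat m n g e u > 0"
  defines "\<sigma> \<equiv> sigma_hat m n e" and "\<beta> \<equiv> beta_hat m u" and "\<mu> \<equiv> mu_hat m n g e u"
  shows "\<sigma> > 0" "\<beta> > 0" "\<mu> > 0" "scalarized_AO m n \<delta> lam loss f"
    and "\<And>j. j < n \<Longrightarrow> r_in m A (\<lambda>j. x0 j + e j) (mu_r_hat m n g e u) u j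
           = x0 j + \<beta> * mu_r_hat m n g e u * h j"
    and "\<And>i. i < m \<Longrightarrow> a_star n A (observation n A x0 w) (\<lambda>j. x0 j + e j) (kappa_hat m n h e u) u i
           = w i + \<sigma> * g i"
    and "\<And>x y. x \<in> pos2 \<Longrightarrow> y \<in> pos2 \<Longrightarrow>
      AO_value m n \<delta> lam loss f g h x0 w (\<sigma>, kappa_hat m n h e u * \<beta>) y
      \<le> AO_value m n \<delta> lam loss f g h x0 w x (\<beta>, sqrt \<delta> * \<sigma> * \<mu>)"
proof -
  define \<kappa>' where "\<kappa>' = kappa_hat m n h e u"
  \<comment> \<open>Division by zero gives 0, so a positive \<open>kappa_hat\<close> excludes
    \<open>\<beta> = 0\<close>; likewise a positive \<open>mu_r_hat\<close> makes
    \<open>\<mu>\<close> positive, which excludes \<open>\<sigma> = 0\<close>.\<close>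
  have "\<beta> \<noteq> 0" using \<kappa> by (auto simp: kappa_hat_def \<beta>_def)
  moreover have "\<beta> \<ge> 0" using vnorm_nonneg[of m u] by (simp add: \<beta>_def beta_hat_def)
  ultimately show \<beta>: "\<beta> > 0" by linarith
  show \<mu>: "\<mu> > 0" using \<mu>r by (simp add: mu_r_hat_def \<mu>_def)
  hence "\<sigma> \<noteq> 0" by (auto simp: mu_hat_def \<sigma>_def \<mu>_def)
  moreover have "\<sigma> \<ge> 0" using vnorm_nonneg[of n e] by (simp add: \<sigma>_def sigma_hat_def)
  ultimately show \<sigma>: "\<sigma> > 0" by linarith
  obtain s where s: "s \<in> subdifferential n (separable_sum n f) (\<lambda>j. x0 j + e j)"
    "\<And>j. j < n \<Longrightarrow> - matT_vec m A u j + lam * s j = 0"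
    "\<And>j. j < n \<Longrightarrow> vdot m g u / (sqrt (real m) * vnorm n e) * e j - vnorm m u / sqrt (real m) * h j + lam * s j = 0"
    and u: "u \<in> subdifferential m (separable_sum m loss) r"
    using sub by (auto simp: common_subgradient_def)
  note sf = subdifferential_separable_sum[OF f_cvx s(1)] and sl = subdifferential_separable_sum[OF loss_cvx u]
  show sAO: "scalarized_AO m n \<delta> lam loss f"
    using dims pos loss_cvx f_cvx sf(3)[OF dims(2)] sl(3)[OF dims(1)] by unfold_locales blast+
  interpret scalarized_AO m n \<delta> lam loss f g h x0 w by (rule sAO)
  have fe: "feasible e r" using sf(1) sl(1) by (simp add: feasible_def)
  obtain c where fin: "separable_sum m loss r + ereal lam * separable_sum n f (\<lambda>j. x0 j + e j) = ereal c"
    using separable_sum_finite[OF loss_cvx, of m r] separable_sum_finite[OF f_cvx, of n "\<lambda>j. x0 j + e j"] fe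
    by (simp add: feasible_def)
  have PO: "r i = w i - mat_vec n A e i" if "i < m" for i
    using PO_saddle_residual[OF matched[unfolded matched_solution_def, THEN conjunct1] fin dims(1) that] .
  have AO: "\<sigma> * g i + w i - r i = \<kappa>' * u i" if "i < m" for i
    unfolding \<sigma>_def \<kappa>'_def
    using AO_saddle_residual[OF matched[unfolded matched_solution_def, THEN conjunct2] fin dims(1) that \<kappa>] .
  have "\<mu> = vdot m g u / (sqrt (real m) * vnorm n e)"
  proof -
    have "real m * (vnorm n e / sqrt (real m)) = sqrt (real m) * vnorm n e"
      using real_div_sqrt[of "real m"] by (metis of_nat_0_le_iff times_divide_eq_left times_divide_eq_right)
    thus ?thesis by (simp add: \<mu>_def mu_hat_def sigma_hat_def)
  qed
  hence lams: "lam * s j = \<beta> * h j - \<mu> * e j" if "j < n" for j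
    using s(3)[OF that] by (simp add: \<beta>_def beta_hat_def)
  \<comment> \<open>The common subgradient is eliminated between the two stationarity conditions;
    dividing by \<open>\<mu>\<close> makes the term in \<open>e j\<close> cancel.\<close>
  show "r_in m A (\<lambda>j. x0 j + e j) (mu_r_hat m n g e u) u j = x0 j + \<beta> * mu_r_hat m n g e u * h j"
    if "j < n" for j
  proof -
    have "matT_vec m A u j = \<beta> * h j - \<mu> * e j" using s(2)[OF that] lams[OF that] by simp
    thus ?thesis using \<mu> by (simp add: r_in_def mu_r_hat_def \<mu>_def[symmetric] field_simps)
  qed
  \<comment> \<open>Here \<open>y - A x = w - A e\<close>, which is \<open>r\<close> by
    \<open>PO\<close>, and \<open>AO\<close> rewrites \<open>r + \<kappa>' u\<close>.\<close>
  show "a_star n A (observation n A x0 w) (\<lambda>j. x0 j + e j) (kappa_hat m n h e u) u i = w i + \<sigma> * g i"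
    if "i < m" for i
    using PO[OF that] AO[OF that]
    by (simp add: a_star_def observation_def \<kappa>'_def mat_vec_def distrib_left sum.distrib)
  show "AO_value m n \<delta> lam loss f g h x0 w (\<sigma>, kappa_hat m n h e u * \<beta>) y
      \<le> AO_value m n \<delta> lam loss f g h x0 w x (\<beta>, sqrt \<delta> * \<sigma> * \<mu>)"
    if xy: "x \<in> pos2" "y \<in> pos2" for x y
  proof (rule KKT_scalar_saddle[OF \<sigma> \<beta> \<mu> \<kappa> fe AO[unfolded \<kappa>'_def] sl(2) sf(2) lams _ _ _ _ xy])
    show "(\<Sum>j<n. (e j)\<^sup>2) = real m * \<sigma>\<^sup>2" "(\<Sum>i<m. (u i)\<^sup>2) = real m * \<beta>\<^sup>2"
      using dims by (auto simp: \<sigma>_def \<beta>_def sigma_hat_def beta_hat_def power_divide vnorm_sq)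
    show "(\<Sum>i<m. g i * u i) = real m * \<sigma> * \<mu>" "(\<Sum>j<n. h j * e j) = real m * \<beta> * kappa_hat m n h e u"
      using dims \<sigma> \<beta> unfolding \<mu>_def mu_hat_def kappa_hat_def \<sigma>_def[symmetric] \<beta>_def[symmetric]
      by (auto simp: vdot_def)
  qed
qed

section \<open>Convergence of the scalar problem and of its saddle point\<close>

lemma AO_value_tendsto:
  assumes prob: "\<And>k. prob_space (M k)"
    and n: "\<And>k. n k > 0" "filterlim n at_top sequentially"
    and ratio: "(\<lambda>k. real (m k) / real (n k)) \<longlonglongrightarrow> \<delta>" and pos: "\<delta> > 0" "lam > 0"
    and h: "\<And>k. std_gaussian_vec (M k) (n k) (h k)"
    and L_limit: "\<And>c \<tau>. c > 0 \<Longrightarrow> \<tau> > 0 \<Longrightarrow>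
      tendsto_in_prob M
        (\<lambda>k \<omega>. prox_value (m k) \<tau> (separable_sum (m k) loss) (\<lambda>i. c * g k \<omega> i + w k \<omega> i)) (\<L> c \<tau>)"
    and F_limit: "\<And>c \<tau>. c > 0 \<Longrightarrow> \<tau> > 0 \<Longrightarrow>
      tendsto_in_prob M
        (\<lambda>k \<omega>. prox_value (n k) \<tau> (separable_sum (n k) f) (\<lambda>j. x0 k \<omega> j + c * h k \<omega> j)) (\<F> c \<tau>)"
    and xy: "x \<in> pos2" "y \<in> pos2"
  shows "tendsto_in_prob M
      (\<lambda>k \<omega>. AO_value (m k) (n k) \<delta> lam loss f (g k \<omega>) (h k \<omega>) (x0 k \<omega>) (w k \<omega>) x y)
      (D_gen \<delta> lam \<L> \<F> (fst x) (snd x) (fst y) (snd y))"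
proof -
  obtain \<sigma> \<tau>g \<beta> \<tau>h where p: "x = (\<sigma>, \<tau>g)" "y = (\<beta>, \<tau>h)" "\<sigma> > 0" "\<tau>g > 0" "\<beta> > 0" "\<tau>h > 0"
    using xy by (auto simp: pos2_def)
  have sd: "sqrt \<delta> > 0" using pos by simp
  define c where "c = \<sigma> * sqrt \<delta> * \<beta> / \<tau>h"
  define t where "t = \<sigma> * sqrt \<delta> * lam / \<tau>h"
  define K where "K = \<sigma> * sqrt \<delta> * \<beta>\<^sup>2 / (2 * \<tau>h)"
  define a where "a = \<beta> * \<tau>g / 2 - \<sigma> * \<tau>h / (2 * sqrt \<delta>)"
  have ct: "c > 0" "t > 0" using p sd pos by (auto simp: c_def t_def)
  have const: "(\<lambda>k. real (m k) / real (n k) * a) \<longlonglongrightarrow> \<delta> * a"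
    by (intro tendsto_mult ratio tendsto_const)
  have lim: "tendsto_in_prob M
      (\<lambda>k \<omega>. ((real (m k) / real (n k) * a
        + real (m k) / real (n k) * prox_value (m k) (\<tau>g / \<beta>) (separable_sum (m k) loss) (\<lambda>i. \<sigma> * g k \<omega> i + w k \<omega> i))
        + lam * prox_value (n k) t (separable_sum (n k) f) (\<lambda>j. x0 k \<omega> j + c * h k \<omega> j))
        + (- K) * (vdot (n k) (h k \<omega>) (h k \<omega>) / real (n k)))
      (((\<delta> * a + \<delta> * \<L> \<sigma> (\<tau>g / \<beta>)) + lam * \<F> c t) + (- K) * 1)"
    using p ct prob
    by (intro tendsto_in_prob_add tendsto_in_prob_const[OF prob const] tendsto_in_prob_mult_left[OF prob ratio]
        tendsto_in_prob_mult_left[OF prob tendsto_const]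
        L_limit F_limit std_gaussian_vec_sq_norm_tendsto[OF prob h n]) auto
  \<comment> \<open>The limit ratio \<open>\<delta>\<close> turns the
    \<open>1 / sqrt \<delta>\<close> of \<open>AO_value\<close> into the
    \<open>sqrt \<delta>\<close> of \<open>D_gen\<close>.\<close>
  have "\<delta> * (\<sigma> * \<tau>h / (2 * sqrt \<delta>)) = (\<delta> / sqrt \<delta>) * (\<sigma> * \<tau>h / 2)" by simp
  also have "\<delta> / sqrt \<delta> = sqrt \<delta>" using pos by (simp add: real_div_sqrt)
  finally have d: "\<delta> * (\<sigma> * \<tau>h / (2 * sqrt \<delta>)) = sqrt \<delta> * (\<sigma> * \<tau>h / 2)" .
  have "\<delta> * a = \<delta> * \<beta> * \<tau>g / 2 - \<sigma> * sqrt \<delta> * \<tau>h / 2"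
    unfolding a_def right_diff_distrib d by (simp add: mult.assoc mult.left_commute)
  hence l: "((\<delta> * a + \<delta> * \<L> \<sigma> (\<tau>g / \<beta>)) + lam * \<F> c t) + (- K) * 1 = D_gen \<delta> lam \<L> \<F> \<sigma> \<tau>g \<beta> \<tau>h"
    by (simp add: D_gen_def c_def t_def K_def)
  show ?thesis
    using lim unfolding l p(1,2) fst_conv snd_conv
    by (simp add: AO_value_def c_def t_def K_def a_def right_diff_distrib algebra_simps)
qed

text \<open>The faces \<open>\<sigma> = 0\<close> and \<open>\<beta> = 0\<close> impose nothing new, since the values there are one-sided limits
  from the interior.\<close>

lemma scalar_AO_saddle_interior_iff:
  assumes z: "x' \<in> pos2" "y' \<in> pos2"
  shows "scalar_AO_saddle \<delta> lam \<L> \<F> (fst x') (snd x') (fst y') (snd y') \<longleftrightarrow>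
    (\<forall>x\<in>pos2. \<forall>y\<in>pos2. D_gen \<delta> lam \<L> \<F> (fst x') (snd x') (fst y) (snd y)
       \<le> D_gen \<delta> lam \<L> \<F> (fst x) (snd x) (fst y') (snd y'))"
proof -
  define D where "D = (\<lambda>x y. D_gen \<delta> lam \<L> \<F> (fst x) (snd x) (fst y) (snd y))"
  define X where "X = {0::real..} \<times> {0::real<..}"
  have ext: "D_gen_ext \<delta> lam \<L> \<F> x y = ereal (D x y)" if "x \<in> pos2" "y \<in> pos2" for x y
    using that by (auto simp: D_gen_ext_def D_def pos2_def)
  have sub: "pos2 \<subseteq> X" by (auto simp: pos2_def X_def)
  have sad: "scalar_AO_saddle \<delta> lam \<L> \<F> (fst x') (snd x') (fst y') (snd y') \<longleftrightarrow>
    (\<forall>y\<in>X. D_gen_ext \<delta> lam \<L> \<F> x' y \<le> ereal (D x' y')) \<and> (\<forall>x\<in>X. ereal (D x' y') \<le> D_gen_ext \<delta> lam \<L> \<F> x y')"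
    using z sub unfolding scalar_AO_saddle_def saddle_point_def X_def[symmetric] prod.collapse ext[OF z] by blast
  have "(\<forall>y\<in>X. D_gen_ext \<delta> lam \<L> \<F> x' y \<le> ereal (D x' y')) \<and> (\<forall>x\<in>X. ereal (D x' y') \<le> D_gen_ext \<delta> lam \<L> \<F> x y')
    \<longleftrightarrow> (\<forall>x\<in>pos2. \<forall>y\<in>pos2. D x' y \<le> D x y')" (is "?l \<longleftrightarrow> ?r")
  proof
    assume l: ?l
    show ?r
    proof (intro ballI)
      fix x y assume xy: "x \<in> pos2" "y \<in> pos2"
      with l sub have "D_gen_ext \<delta> lam \<L> \<F> x' y \<le> ereal (D x' y')" "ereal (D x' y') \<le> D_gen_ext \<delta> lam \<L> \<F> x y'"
        by blast+
      thus "D x' y \<le> D x y'" using xy z by (simp add: ext)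
    qed
  next
    assume r: ?r
    hence up: "D x' y \<le> D x' y'" and lo: "D x' y' \<le> D y y'" if "y \<in> pos2" for y
      using z that by auto
    show ?l
    proof (intro conjI ballI)
      fix y assume y: "y \<in> X"
      show "D_gen_ext \<delta> lam \<L> \<F> x' y \<le> ereal (D x' y')"
      proof (cases "y \<in> pos2")
        case False
        hence "fst y = 0" "snd y > 0" using y by (auto simp: X_def pos2_def)
        then obtain t where y: "y = (0, t)" "t > 0" by (metis prod.collapse)
        \<comment> \<open>On this face the extended value is an upper limit of interior values, all
          of which obey the bound.\<close>
        have "\<forall>\<^sub>F b in at_right 0. ereal (D x' (b, t)) \<le> ereal (D x' y')"
          using eventually_at_right_less[of "0::real"]
          by eventually_elim (use up y in \<open>simp add: pos2_def\<close>)
        from Limsup_bounded[OF this] show ?thesis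
          using z by (auto simp: D_gen_ext_def y D_def pos2_def)
      qed (use up z in \<open>simp add: ext\<close>)
    next
      fix x assume x: "x \<in> X"
      show "ereal (D x' y') \<le> D_gen_ext \<delta> lam \<L> \<F> x y'"
      proof (cases "x \<in> pos2")
        case False
        hence "fst x = 0" "snd x > 0" using x by (auto simp: X_def pos2_def)
        then obtain t where x: "x = (0, t)" "t > 0" by (metis prod.collapse)
        have "\<forall>\<^sub>F s in at_right 0. ereal (D x' y') \<le> ereal (D (s, t) y')"
          using eventually_at_right_less[of "0::real"]
          by eventually_elim (use lo x in \<open>simp add: pos2_def\<close>)
        from Liminf_bounded[OF this] show ?thesis
          using z by (auto simp: D_gen_ext_def x D_def pos2_def)
      qed (use lo z in \<open>simp add: ext\<close>)
    qed
  qed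
  thus ?thesis unfolding sad D_def by simp
qed

theorem theorem6:
  fixes M :: "nat \<Rightarrow> 'w measure"
    and m n :: "nat \<Rightarrow> nat"
    and \<delta> lam :: real
    and pX pW :: "real measure"
    and loss f :: "real \<Rightarrow> ereal"
    and A :: "nat \<Rightarrow> 'w \<Rightarrow> rmat"
    and x0 w g h e u r :: "nat \<Rightarrow> 'w \<Rightarrow> rvec"
    and \<L> \<F> :: "real \<Rightarrow> real \<Rightarrow> real"
    and \<sigma>s \<tau>gs \<beta>s \<tau>hs :: real
  assumes prob: "\<And>k. prob_space (M k)"
    and dims_pos: "\<And>k. m k > 0" "\<And>k. n k > 0"
    and dims_lim: "filterlim m at_top sequentially" "filterlim n at_top sequentially"
    and ratio: "(\<lambda>k. real (m k) / real (n k)) \<longlonglongrightarrow> \<delta>"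
    and pos: "\<delta> > 0" "lam > 0"
    and loss_convex: "proper_closed_convex loss"
    and regularizer_convex: "proper_closed_convex f"
    and model: "\<And>k. gaussian_linear_model (M k) (m k) (n k) pX pW (A k) (x0 k) (w k)"
    and AO_vectors: "\<And>k. AO_gaussians (M k) (m k) (n k) (x0 k) (w k) (g k) (h k)"
    and measurable_solution:
      "\<And>k j. j < n k \<Longrightarrow> (\<lambda>\<omega>. e k \<omega> j) \<in> borel_measurable (M k)"
      "\<And>k i. i < m k \<Longrightarrow> (\<lambda>\<omega>. u k \<omega> i) \<in> borel_measurable (M k)"
      "\<And>k i. i < m k \<Longrightarrow> (\<lambda>\<omega>. r k \<omega> i) \<in> borel_measurable (M k)"
    and matching: "\<And>k. AE \<omega> in M k.
      matched_solution (m k) (n k) (separable_sum (m k) loss) (separable_sum (n k) f) lam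
        (A k \<omega>) (x0 k \<omega>) (w k \<omega>) (g k \<omega>) (h k \<omega>) (e k \<omega>) (u k \<omega>) (r k \<omega>)"
    and subgradient: "\<And>k. AE \<omega> in M k.
      common_subgradient (m k) (n k) (separable_sum (m k) loss) (separable_sum (n k) f) lam
        (A k \<omega>) (x0 k \<omega>) (g k \<omega>) (h k \<omega>) (e k \<omega>) (u k \<omega>) (r k \<omega>)"
    and scalars_pos: "\<And>k. AE \<omega> in M k.
      kappa_hat (m k) (n k) (h k \<omega>) (e k \<omega>) (u k \<omega>) > 0 \<and>
      mu_r_hat (m k) (n k) (g k \<omega>) (e k \<omega>) (u k \<omega>) > 0"
    and L_limit: "\<And>c \<tau>. c > 0 \<Longrightarrow> \<tau> > 0 \<Longrightarrow>
      tendsto_in_prob M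
        (\<lambda>k \<omega>. prox_value (m k) \<tau> (separable_sum (m k) loss) (\<lambda>i. c * g k \<omega> i + w k \<omega> i)) (\<L> c \<tau>)"
    and F_limit: "\<And>c \<tau>. c > 0 \<Longrightarrow> \<tau> > 0 \<Longrightarrow>
      tendsto_in_prob M
        (\<lambda>k \<omega>. prox_value (n k) \<tau> (separable_sum (n k) f) (\<lambda>j. x0 k \<omega> j + c * h k \<omega> j)) (\<F> c \<tau>)"
    and saddle: "unique_interior_saddle \<delta> lam \<L> \<F> \<sigma>s \<tau>gs \<beta>s \<tau>hs"
  shows "\<exists>\<tau>_hat :: nat \<Rightarrow> 'w \<Rightarrow> real.
    (\<forall>k. AE \<omega> in M k.
       (\<forall>j<n k.
          r_in (m k) (A k \<omega>) (\<lambda>j. x0 k \<omega> j + e k \<omega> j)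
            (mu_r_hat (m k) (n k) (g k \<omega>) (e k \<omega>) (u k \<omega>)) (u k \<omega>) j
          = x0 k \<omega> j + \<tau>_hat k \<omega> * h k \<omega> j) \<and>
       (\<forall>i<m k.
          a_star (n k) (A k \<omega>) (observation (n k) (A k \<omega>) (x0 k \<omega>) (w k \<omega>))
            (\<lambda>j. x0 k \<omega> j + e k \<omega> j)
            (kappa_hat (m k) (n k) (h k \<omega>) (e k \<omega>) (u k \<omega>)) (u k \<omega>) i
          = w k \<omega> i + sigma_hat (m k) (n k) (e k \<omega>) * g k \<omega> i)) \<and>
    tendsto_in_prob M \<tau>_hat (sqrt \<delta> * \<sigma>s * \<beta>s / \<tau>hs) \<and>
    tendsto_in_prob M (\<lambda>k \<omega>. sigma_hat (m k) (n k) (e k \<omega>)) \<sigma>s"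
proof -
  define sg where "sg = (\<lambda>k \<omega>. sigma_hat (m k) (n k) (e k \<omega>))"
  define bt where "bt = (\<lambda>k \<omega>. beta_hat (m k) (u k \<omega>))"
  define mu where "mu = (\<lambda>k \<omega>. mu_hat (m k) (n k) (g k \<omega>) (e k \<omega>) (u k \<omega>))"
  define kp where "kp = (\<lambda>k \<omega>. kappa_hat (m k) (n k) (h k \<omega>) (e k \<omega>) (u k \<omega>))"
  define \<tau>_hat where "\<tau>_hat = (\<lambda>k \<omega>. bt k \<omega> * mu_r_hat (m k) (n k) (g k \<omega>) (e k \<omega>) (u k \<omega>))"
  \<comment> \<open>The almost sure event on which the deterministic results apply.\<close>
  define good where "good = (\<lambda>k \<omega>.
      matched_solution (m k) (n k) (separable_sum (m k) loss) (separable_sum (n k) f) lam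
        (A k \<omega>) (x0 k \<omega>) (w k \<omega>) (g k \<omega>) (h k \<omega>) (e k \<omega>) (u k \<omega>) (r k \<omega>) \<and>
      common_subgradient (m k) (n k) (separable_sum (m k) loss) (separable_sum (n k) f) lam
        (A k \<omega>) (x0 k \<omega>) (g k \<omega>) (h k \<omega>) (e k \<omega>) (u k \<omega>) (r k \<omega>) \<and>
      kp k \<omega> > 0 \<and> mu_r_hat (m k) (n k) (g k \<omega>) (e k \<omega>) (u k \<omega>) > 0)"
  have good: "AE \<omega> in M k. good k \<omega>" for k
    using matching[of k] subgradient[of k] scalars_pos[of k]
    by eventually_elim (simp add: good_def kp_def)
  define V where "V = (\<lambda>k \<omega>. AO_value (m k) (n k) \<delta> lam loss f (g k \<omega>) (h k \<omega>) (x0 k \<omega>) (w k \<omega>))"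
  define D where "D = (\<lambda>x y. D_gen \<delta> lam \<L> \<F> (fst x) (snd x) (fst y) (snd y))"
  have scal: "sg k \<omega> > 0" "bt k \<omega> > 0" "mu k \<omega> > 0" "scalarized_AO (m k) (n k) \<delta> lam loss f"
    and r_in_eq: "\<And>j. j < n k \<Longrightarrow> r_in (m k) (A k \<omega>) (\<lambda>j. x0 k \<omega> j + e k \<omega> j)
            (mu_r_hat (m k) (n k) (g k \<omega>) (e k \<omega>) (u k \<omega>)) (u k \<omega>) j = x0 k \<omega> j + \<tau>_hat k \<omega> * h k \<omega> j"
    and a_eq: "\<And>i. i < m k \<Longrightarrow> a_star (n k) (A k \<omega>) (observation (n k) (A k \<omega>) (x0 k \<omega>) (w k \<omega>))
            (\<lambda>j. x0 k \<omega> j + e k \<omega> j) (kappa_hat (m k) (n k) (h k \<omega>) (e k \<omega>) (u k \<omega>)) (u k \<omega>) i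
          = w k \<omega> i + sigma_hat (m k) (n k) (e k \<omega>) * g k \<omega> i"
    and V_saddle: "\<And>x y. x \<in> pos2 \<Longrightarrow> y \<in> pos2 \<Longrightarrow>
      V k \<omega> (sg k \<omega>, kp k \<omega> * bt k \<omega>) y \<le> V k \<omega> x (bt k \<omega>, sqrt \<delta> * sg k \<omega> * mu k \<omega>)"
    if "good k \<omega>" for k \<omega>
  proof -
    note gd = that[unfolded good_def kp_def]
    note * = matched_solution_scalars[OF dims_pos(1)[of k] dims_pos(2)[of k] pos loss_convex regularizer_convex
      gd[THEN conjunct1] gd[THEN conjunct2, THEN conjunct1] gd[THEN conjunct2, THEN conjunct2, THEN conjunct1]
      gd[THEN conjunct2, THEN conjunct2, THEN conjunct2]]
    show "sg k \<omega> > 0" "bt k \<omega> > 0" "mu k \<omega> > 0" "scalarized_AO (m k) (n k) \<delta> lam loss f"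
      using *(1-4) by (simp_all add: sg_def bt_def mu_def)
    show "r_in (m k) (A k \<omega>) (\<lambda>j. x0 k \<omega> j + e k \<omega> j)
            (mu_r_hat (m k) (n k) (g k \<omega>) (e k \<omega>) (u k \<omega>)) (u k \<omega>) j = x0 k \<omega> j + \<tau>_hat k \<omega> * h k \<omega> j"
      if "j < n k" for j using *(5)[OF that] by (simp add: \<tau>_hat_def bt_def)
    show "a_star (n k) (A k \<omega>) (observation (n k) (A k \<omega>) (x0 k \<omega>) (w k \<omega>))
            (\<lambda>j. x0 k \<omega> j + e k \<omega> j) (kappa_hat (m k) (n k) (h k \<omega>) (e k \<omega>) (u k \<omega>)) (u k \<omega>) i
          = w k \<omega> i + sigma_hat (m k) (n k) (e k \<omega>) * g k \<omega> i"
      if "i < m k" for i using *(6)[OF that] .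
    show "V k \<omega> (sg k \<omega>, kp k \<omega> * bt k \<omega>) y \<le> V k \<omega> x (bt k \<omega>, sqrt \<delta> * sg k \<omega> * mu k \<omega>)"
      if "x \<in> pos2" "y \<in> pos2" for x y
      using *(7)[OF that] by (simp add: V_def sg_def kp_def bt_def mu_def)
  qed
  have h_gauss: "std_gaussian_vec (M k) (n k) (h k)" and g_gauss: "std_gaussian_vec (M k) (m k) (g k)" for k
    using AO_vectors by (auto simp: AO_gaussians_def)
  have V_lim: "tendsto_in_prob M (\<lambda>k \<omega>. V k \<omega> (fst p) (snd p)) (D (fst p) (snd p))" if "p \<in> pos2 \<times> pos2" for p
    unfolding V_def D_def using that
    by (intro AO_value_tendsto[OF prob dims_pos(2) dims_lim(2) ratio pos h_gauss L_limit F_limit]) auto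
  have xs: "(\<sigma>s, \<tau>gs) \<in> pos2" and ys: "(\<beta>s, \<tau>hs) \<in> pos2"
    using saddle by (auto simp: unique_interior_saddle_def pos2_def)
  have D_saddle: "D (\<sigma>s, \<tau>gs) y \<le> D x (\<beta>s, \<tau>hs)" if "x \<in> pos2" "y \<in> pos2" for x y
    using saddle scalar_AO_saddle_interior_iff[OF xs ys, of \<delta> lam \<L> \<F>] that
    by (simp add: unique_interior_saddle_def D_def)
  have D_unique: "(x', y') = ((\<sigma>s, \<tau>gs), (\<beta>s, \<tau>hs))"
    if "x' \<in> pos2" "y' \<in> pos2" "\<And>x y. x \<in> pos2 \<Longrightarrow> y \<in> pos2 \<Longrightarrow> D x' y \<le> D x y'" for x' y'
  proof -
    have "scalar_AO_saddle \<delta> lam \<L> \<F> (fst x') (snd x') (fst y') (snd y')"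
      using scalar_AO_saddle_interior_iff[OF that(1,2)] that(3) by (simp add: D_def)
    moreover have "fst x' > 0" "snd x' > 0" "fst y' > 0" "snd y' > 0" using that(1,2) by (auto simp: pos2_def)
    ultimately show ?thesis using saddle unfolding unique_interior_saddle_def by (metis prod.collapse)
  qed
  have open_pos2: "open pos2" by (simp add: pos2_def open_Times)
  \<comment> \<open>Stability of the saddle point combined with continuous mapping. \<open>Y\<close>
    has to agree with \<open>\<phi>\<close> of the empirical saddle point on \<open>good\<close>
    only; the claim is used for \<open>\<tau>_hat\<close> and for \<open>sg\<close>.\<close>
  have conv: "tendsto_in_prob M Y (\<phi> ((\<sigma>s, \<tau>gs), (\<beta>s, \<tau>hs)))"
    if meas: "\<And>k. Y k \<in> borel_measurable (M k)"
      and Y: "\<And>k \<omega>. good k \<omega> \<Longrightarrow> Y k \<omega> = \<phi> ((sg k \<omega>, kp k \<omega> * bt k \<omega>), (bt k \<omega>, sqrt \<delta> * sg k \<omega> * mu k \<omega>))"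
      and cont: "isCont \<phi> ((\<sigma>s, \<tau>gs), (\<beta>s, \<tau>hs))"
    for Y and \<phi> :: "(real \<times> real) \<times> (real \<times> real) \<Rightarrow> real"
  proof (rule tendsto_in_prob_finite_control[OF prob meas,
      where X="\<lambda>p k \<omega>. V k \<omega> (fst p) (snd p)" and l="\<lambda>p. D (fst p) (snd p)"])
    fix \<epsilon> :: real assume "\<epsilon> > 0"
    with cont obtain \<rho> where \<rho>: "\<rho> > 0"
      "\<And>z. dist z ((\<sigma>s, \<tau>gs), (\<beta>s, \<tau>hs)) < \<rho> \<Longrightarrow> dist (\<phi> z) (\<phi> ((\<sigma>s, \<tau>gs), (\<beta>s, \<tau>hs))) < \<epsilon>"
      unfolding continuous_at_eps_delta by blast
    obtain S \<eta> where S: "finite S" "S \<subseteq> pos2 \<times> pos2" "\<eta> > 0"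
      "\<And>v x y. \<lbrakk>\<forall>y\<in>pos2. convex_on pos2 (\<lambda>x. v x y); \<forall>x\<in>pos2. concave_on pos2 (v x);
           \<forall>p\<in>S. \<bar>v (fst p) (snd p) - D (fst p) (snd p)\<bar> \<le> \<eta>; x \<in> pos2; y \<in> pos2;
           \<And>x' y'. x' \<in> pos2 \<Longrightarrow> y' \<in> pos2 \<Longrightarrow> v x y' \<le> v x' y\<rbrakk>
         \<Longrightarrow> dist ((\<sigma>s, \<tau>gs), (\<beta>s, \<tau>hs)) (x, y) < \<rho>"
    proof (rule saddle_point_stability[where D=D, OF open_pos2 open_pos2 xs ys _ _ \<rho>(1)], goal_cases)
      case (1 x y)
      show ?case by (rule D_saddle[OF 1(2,3)])
    next
      case (2 x' y')
      show ?case by (rule D_unique[OF 2(2-4)])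
    next
      case (3 S \<eta>)
      show ?case by (rule that[OF 3(2-5)])
    qed
    have "\<bar>Y k \<omega> - \<phi> ((\<sigma>s, \<tau>gs), (\<beta>s, \<tau>hs))\<bar> \<le> \<epsilon>"
      if gd: "good k \<omega>" and cl: "\<forall>p\<in>S. \<bar>V k \<omega> (fst p) (snd p) - D (fst p) (snd p)\<bar> \<le> \<eta>" for k \<omega>
    proof -
      interpret scalarized_AO "m k" "n k" \<delta> lam loss f "g k \<omega>" "h k \<omega>" "x0 k \<omega>" "w k \<omega>" by (rule scal(4)[OF gd])
      have "kp k \<omega> > 0" using gd by (simp add: good_def)
      hence "dist ((\<sigma>s, \<tau>gs), (\<beta>s, \<tau>hs)) ((sg k \<omega>, kp k \<omega> * bt k \<omega>), (bt k \<omega>, sqrt \<delta> * sg k \<omega> * mu k \<omega>)) < \<rho>"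
        using val_convex_on val_concave_on cl scal(1-3)[OF gd] pos V_saddle[OF gd]
        by (intro S(4)[of "V k \<omega>"]) (auto simp: V_def pos2_def)
      with \<rho>(2) show ?thesis unfolding Y[OF gd] by (simp add: dist_commute dist_real_def less_imp_le)
    qed
    hence ae: "AE \<omega> in M k. (\<forall>p\<in>S. \<bar>V k \<omega> (fst p) (snd p) - D (fst p) (snd p)\<bar> \<le> \<eta>) \<longrightarrow>
         \<bar>Y k \<omega> - \<phi> ((\<sigma>s, \<tau>gs), (\<beta>s, \<tau>hs))\<bar> \<le> \<epsilon>" for k
      using good[of k] by (auto elim: eventually_mono)
    show "\<exists>S \<eta>. finite S \<and> \<eta> > 0 \<and>
      (\<forall>p\<in>S. tendsto_in_prob M (\<lambda>k \<omega>. V k \<omega> (fst p) (snd p)) (D (fst p) (snd p))) \<and>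
      (\<forall>\<^sub>F k in sequentially. AE \<omega> in M k. (\<forall>p\<in>S. \<bar>V k \<omega> (fst p) (snd p) - D (fst p) (snd p)\<bar> \<le> \<eta>) \<longrightarrow>
         \<bar>Y k \<omega> - \<phi> ((\<sigma>s, \<tau>gs), (\<beta>s, \<tau>hs))\<bar> \<le> \<epsilon>)"
    proof (intro exI[of _ S] exI[of _ \<eta>] conjI ballI)
      show "\<forall>\<^sub>F k in sequentially. AE \<omega> in M k.
          (\<forall>p\<in>S. \<bar>V k \<omega> (fst p) (snd p) - D (fst p) (snd p)\<bar> \<le> \<eta>) \<longrightarrow>
          \<bar>Y k \<omega> - \<phi> ((\<sigma>s, \<tau>gs), (\<beta>s, \<tau>hs))\<bar> \<le> \<epsilon>"
        by (rule always_eventually, rule allI, rule ae)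
    qed (use S(1-3) V_lim in auto)
  qed
  have g_meas: "(\<lambda>\<omega>. g k \<omega> i) \<in> borel_measurable (M k)" if "i < m k" for k i
    using g_gauss[of k] that distributed_measurable by (fastforce simp: std_gaussian_vec_def)
  have sg_meas: "sg k \<in> borel_measurable (M k)" for k
    unfolding sg_def sigma_hat_def vnorm_def L2_set_def using measurable_solution(1) by measurable
  have "\<tau>_hat k \<in> borel_measurable (M k)" for k
  proof -
    note [measurable] = sg_meas[unfolded sg_def]
    show ?thesis
      unfolding \<tau>_hat_def bt_def mu_r_hat_def mu_hat_def beta_hat_def vnorm_def L2_set_def vdot_def
      using measurable_solution(2) g_meas by measurable
  qed
  \<comment> \<open>At the empirical saddle point the fourth coordinate is
    \<open>sqrt \<delta> * sg * mu\<close>, so this \<open>\<phi>\<close> reduces to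
    \<open>bt / mu\<close>, which is \<open>\<tau>_hat\<close>.\<close>
  hence "tendsto_in_prob M \<tau>_hat ((\<lambda>z. sqrt \<delta> * fst (fst z) * fst (snd z) / snd (snd z)) ((\<sigma>s, \<tau>gs), (\<beta>s, \<tau>hs)))"
  proof (rule conv)
    fix k \<omega> assume "good k \<omega>"
    with scal[OF this] pos show "\<tau>_hat k \<omega> =
      (\<lambda>z. sqrt \<delta> * fst (fst z) * fst (snd z) / snd (snd z)) ((sg k \<omega>, kp k \<omega> * bt k \<omega>), (bt k \<omega>, sqrt \<delta> * sg k \<omega> * mu k \<omega>))"
      by (simp add: \<tau>_hat_def mu_r_hat_def mu_def)
  next
    show "isCont (\<lambda>z. sqrt \<delta> * fst (fst z) * fst (snd z) / snd (snd z)) ((\<sigma>s, \<tau>gs), (\<beta>s, \<tau>hs))"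
      using ys by (intro continuous_intros) (auto simp: pos2_def)
  qed
  moreover have "tendsto_in_prob M sg ((\<lambda>z. fst (fst z)) ((\<sigma>s, \<tau>gs), (\<beta>s, \<tau>hs)))"
    by (rule conv[OF sg_meas]) (auto intro!: continuous_intros)
  moreover have "AE \<omega> in M k.
       (\<forall>j<n k.
          r_in (m k) (A k \<omega>) (\<lambda>j. x0 k \<omega> j + e k \<omega> j)
            (mu_r_hat (m k) (n k) (g k \<omega>) (e k \<omega>) (u k \<omega>)) (u k \<omega>) j
          = x0 k \<omega> j + \<tau>_hat k \<omega> * h k \<omega> j) \<and>
       (\<forall>i<m k.
          a_star (n k) (A k \<omega>) (observation (n k) (A k \<omega>) (x0 k \<omega>) (w k \<omega>))
            (\<lambda>j. x0 k \<omega> j + e k \<omega> j)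
            (kappa_hat (m k) (n k) (h k \<omega>) (e k \<omega>) (u k \<omega>)) (u k \<omega>) i
          = w k \<omega> i + sigma_hat (m k) (n k) (e k \<omega>) * g k \<omega> i)" for k
    using good[of k] by eventually_elim (use r_in_eq a_eq in blast)
  ultimately show ?thesis by (intro exI[of _ \<tau>_hat]) (simp add: sg_def)
qed

end
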